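(* There is an open dense set of maps $\mathcal{O}\subset C_{\lambda}(\mathbb{S}^1)$ such that: (1) each $f\in \mathcal{O}$ is leo (locally eventually onto); (2) for each pair $\alpha,\beta\in [0,1)$ and each $f\in \mathcal{O}$ the map $T_{\alpha,\beta}(f)$ belongs to $\mathcal{O}$.
   Context: The circle $\mathbb{S}^1$ is identified with $[0,1)$ (i.e. $\mathbb{R}/\mathbb{Z}$) and $\lambda$ denotes normalized Lebesgue measure on $\mathbb{S}^1$. $C_{\lambda}(\mathbb{S}^1)$ is the set of all continuous maps $f:\mathbb{S}^1\to\mathbb{S}^1$ that preserve $\lambda$ (i.e. $\lambda(f^{-1}(A))=\lambda(A)$ for all Borel $A$), equipped with the uniform metric $\rho(f,g)=\sup_{x\in\mathbb{S}^1}|f(x)-g(x)|$, where $|\cdot|$ is distance on the circle. "Open" and "dense" refer to this metric. A map $f$ is leo (locally eventually onto) if for every nonempty open set $U\subset\mathbb{S}^1$ there is $n\in\mathbb{N}$ such that $f^n(U)=\mathbb{S}^1$. For $\alpha\in[0,1)$, $r_\alpha:\mathbb{S}^1\to\mathbb{S}^1$ is the rotation $r_\alpha(x)=x+\alpha \pmod 1$. For $(\alpha,\beta)\in[0,1)^2$, $T_{\alpha,\beta}:C_\lambda(\mathbb{S}^1)\to C_\lambda(\mathbb{S}^1)$ is defined by $T_{\alpha,\beta}(f)=r_\alpha\circ f\circ r_\beta$. *)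

theory Defs
  imports "HOL-Analysis.Analysis"
begin

text \<open>The circle is \<open>[0,1)\<close> with the metric of \<open>\<real>/\<int>\<close>, that is, arc length for total
  length \<open>1\<close>. Its topology, and hence \<^term>\<open>borel\<close>, is the one of this metric, not the subspace
  topology of \<open>[0,1)\<close> in the real line.\<close>

typedef circle = "{0..<1::real}"
  by (rule exI[of _ 0]) simp

instantiation circle :: metric_space
begin

definition dist_circle :: "circle \<Rightarrow> circle \<Rightarrow> real" where
  "dist_circle x y =
     min \<bar>Rep_circle x - Rep_circle y\<bar> (1 - \<bar>Rep_circle x - Rep_circle y\<bar>)"

definition uniformity_circle :: "(circle \<times> circle) filter" where
  "uniformity_circle = (INF e\<in>{0<..}. principal {(x, y). dist x y < e})"

definition open_circle :: "circle set \<Rightarrow> bool" where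
  "open_circle U \<longleftrightarrow> (\<forall>x\<in>U. \<forall>\<^sub>F (x', y) in uniformity. x' = x \<longrightarrow> y \<in> U)"

instance
proof
  fix x y z :: circle
  have bounds: "0 \<le> Rep_circle u" "Rep_circle u < 1" for u
    using Rep_circle[of u] by auto
  show "dist x y = 0 \<longleftrightarrow> x = y"
    using bounds[of x] bounds[of y]
    by (auto simp: dist_circle_def Rep_circle_inject[symmetric] min_def abs_if split: if_splits)
  show "dist x y \<le> dist x z + dist y z"
    using bounds[of x] bounds[of y] bounds[of z]
    by (simp add: dist_circle_def min_def abs_if)
qed (rule uniformity_circle_def open_circle_def)+

end

definition to_circle :: "real \<Rightarrow> circle" where
  "to_circle t = Abs_circle (frac t)"

lemma Rep_to_circle: "Rep_circle (to_circle t) = frac t"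
  by (simp add: to_circle_def Abs_circle_inverse frac_lt_1)

lemma to_circle_Rep: "to_circle (Rep_circle x) = x"
  using Rep_circle[of x] by (auto simp: to_circle_def frac_eq Rep_circle_inverse)

lemma dist_to_circle_le: "dist (to_circle s) (to_circle t) \<le> \<bar>s - t\<bar>"
proof -
  have *: "s - t = of_int (\<lfloor>s\<rfloor> - \<lfloor>t\<rfloor>) + (frac s - frac t)"
    by (simp add: frac_def)
  have b: "0 \<le> frac s" "frac s < 1" "0 \<le> frac t" "frac t < 1"
    by (simp_all add: frac_lt_1)
  define k where "k = \<lfloor>s\<rfloor> - \<lfloor>t\<rfloor>"
  consider "k = 0" | "k \<ge> 1" | "k \<le> -1" by linarith
  then show ?thesis
  proof cases
    case 1
    then show ?thesis using * by (simp add: dist_circle_def Rep_to_circle k_def)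
  next
    case 2
    then have "real_of_int k \<ge> 1" by linarith
    then show ?thesis using * b unfolding dist_circle_def Rep_to_circle k_def by linarith
  next
    case 3
    then have "real_of_int k \<le> -1" by linarith
    then show ?thesis using * b unfolding dist_circle_def Rep_to_circle k_def by linarith
  qed
qed

lemma continuous_on_to_circle: "continuous_on S to_circle"
  unfolding continuous_on_iff
  by (metis dist_to_circle_le dist_real_def order_le_less_trans)

lemma dist_circle_le: "dist (x::circle) y \<le> 1 / 2"
  by (simp add: dist_circle_def min_def)

definition lambda :: "circle measure" where
  "lambda = distr (restrict_space lborel {0..<1}) borel to_circle"

definition C_lambda :: "(circle \<Rightarrow> circle) set" where
  "C_lambda = {f. continuous_on UNIV f \<and>
     (\<forall>A\<in>sets borel. emeasure lambda (f -` A) = emeasure lambda A)}"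

definition rho :: "(circle \<Rightarrow> circle) \<Rightarrow> (circle \<Rightarrow> circle) \<Rightarrow> real" where
  "rho f g = (SUP x. dist (f x) (g x))"

abbreviation C_lambda_topology :: "(circle \<Rightarrow> circle) topology" where
  "C_lambda_topology \<equiv> Metric_space.mtopology C_lambda rho"

definition leo :: "(circle \<Rightarrow> circle) \<Rightarrow> bool" where
  "leo f \<longleftrightarrow> (\<forall>U. open U \<and> U \<noteq> {} \<longrightarrow> (\<exists>n. (f ^^ n) ` U = UNIV))"

definition rot :: "real \<Rightarrow> circle \<Rightarrow> circle" where
  "rot \<alpha> x = to_circle (Rep_circle x + \<alpha>)"

definition T :: "real \<Rightarrow> real \<Rightarrow> (circle \<Rightarrow> circle) \<Rightarrow> circle \<Rightarrow> circle" where
  "T \<alpha> \<beta> f = rot \<alpha> \<circ> f \<circ> rot \<beta>"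

lemma sets_lambda [simp]: "sets lambda = sets borel"
  and space_lambda [simp]: "space lambda = UNIV"
  by (simp_all add: lambda_def)

lemma to_circle_borel_measurable [measurable]: "to_circle \<in> borel_measurable borel"
  by (intro borel_measurable_continuous_onI continuous_on_to_circle)

lemma to_circle_measurable: "to_circle \<in> restrict_space lborel {0..<1} \<rightarrow>\<^sub>M borel"
  by (rule measurable_restrict_space1) simp

lemma emeasure_lambda:
  assumes "A \<in> sets borel"
  shows "emeasure lambda A = emeasure lborel (to_circle -` A \<inter> {0..<1})"
  using assms to_circle_measurable
  by (simp add: lambda_def emeasure_distr space_restrict_space emeasure_restrict_space)

lemma emeasure_lambda_UNIV: "emeasure lambda UNIV = 1"
  by (simp add: emeasure_lambda)

lemma Metric_space_C_lambda: "Metric_space C_lambda rho"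
proof
  have bdd: "bdd_above (range (\<lambda>x. dist (f x) (g x)))" for f g :: "circle \<Rightarrow> circle"
    using dist_circle_le by (intro bdd_aboveI2)
  have up: "dist (f x) (g x) \<le> rho f g" for f g x
    unfolding rho_def by (rule cSUP_upper[OF _ bdd]) simp
  show nn: "0 \<le> rho f g" for f g
    using up[of f undefined g] zero_le_dist order_trans by blast
  show "rho f g = rho g f" for f g
    by (simp add: rho_def dist_commute)
  show "rho f g = 0 \<longleftrightarrow> f = g" for f g
  proof
    assume "rho f g = 0"
    then show "f = g" using up[of f _ g] by (auto intro!: ext)
  qed (simp add: rho_def)
  show "rho f h \<le> rho f g + rho g h" for f g h
    unfolding rho_def[of f h]
  proof (rule cSUP_least)
    show "dist (f x) (h x) \<le> rho f g + rho g h" for x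
      using dist_triangle[of "f x" "h x" "g x"] up[of f x g] up[of g x h] by linarith
  qed simp
qed

lemma to_circle_eq_iff: "to_circle s = to_circle t \<longleftrightarrow> frac s = frac t"
  by (metis Rep_to_circle to_circle_def)

lemma rot_to_circle: "rot \<alpha> (to_circle t) = to_circle (t + \<alpha>)"
proof -
  have "frac t + \<alpha> = (t + \<alpha>) + of_int (- \<lfloor>t\<rfloor>)" by (simp add: frac_def)
  then have "frac (frac t + \<alpha>) = frac (t + \<alpha>)" by (metis frac_add_of_int_right)
  then show ?thesis by (simp add: rot_def Rep_to_circle to_circle_eq_iff)
qed

lemma rot_lipschitz: "dist (rot \<alpha> x) (rot \<alpha> y) \<le> dist x y"
proof -
  have b: "0 \<le> Rep_circle u" "Rep_circle u < 1" for u
    using Rep_circle[of u] by auto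
  have per: "to_circle (t + 1) = to_circle t" "to_circle (t - 1) = to_circle t" for t
    using frac_add_of_int_right[of t 1] frac_add_of_int_right[of t "-1"]
    by (simp_all add: to_circle_eq_iff)
  let ?s = "Rep_circle x + \<alpha>" and ?t = "Rep_circle y + \<alpha>"
  have 1: "dist (rot \<alpha> x) (rot \<alpha> y) \<le> \<bar>?s - ?t\<bar>"
    unfolding rot_def by (rule dist_to_circle_le)
  have 2: "dist (rot \<alpha> x) (rot \<alpha> y) \<le> \<bar>?s + 1 - ?t\<bar>"
    using dist_to_circle_le[of "?s + 1" ?t] by (simp add: rot_def per)
  have 3: "dist (rot \<alpha> x) (rot \<alpha> y) \<le> \<bar>?s - 1 - ?t\<bar>"
    using dist_to_circle_le[of "?s - 1" ?t] by (simp add: rot_def per)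
  show ?thesis
    using 1 2 3 b[of x] b[of y] unfolding dist_circle_def[of x y] min_def by argo
qed

lemma continuous_on_rot: "continuous_on S (rot \<alpha>)"
  unfolding continuous_on_iff by (metis rot_lipschitz order_le_less_trans)

lemma emeasure_lborel_translate:
  assumes "S \<in> sets borel"
  shows "emeasure lborel ((\<lambda>t. t + c) -` S) = emeasure lborel (S :: real set)"
proof -
  have "emeasure lborel S = emeasure (distr lborel borel ((+) c)) S"
    by (simp add: lborel_distr_plus)
  also have "\<dots> = emeasure lborel ((+) c -` S)"
    using assms by (subst emeasure_distr) auto
  also have "(+) c = (\<lambda>t. t + c)" by (auto simp: add.commute)
  finally show ?thesis by simp
qed

lemma rot_in_C_lambda:
  assumes "\<alpha> \<in> {0..<1}"
  shows "rot \<alpha> \<in> C_lambda"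
proof -
  have "emeasure lambda (rot \<alpha> -` A) = emeasure lambda A" if A: "A \<in> sets borel" for A
  proof -
    define B where "B = to_circle -` A"
    have B [measurable]: "B \<in> sets borel"
      unfolding B_def using A measurable_sets[OF to_circle_borel_measurable] by simp
    have per: "t + 1 \<in> B \<longleftrightarrow> t \<in> B" for t
      using frac_add_of_int_right[of t 1]
      by (simp add: B_def) (metis to_circle_eq_iff)
    have m: "rot \<alpha> \<in> borel_measurable borel"
      by (intro borel_measurable_continuous_onI continuous_on_rot)
    have "emeasure lambda (rot \<alpha> -` A) = emeasure lborel (to_circle -` (rot \<alpha> -` A) \<inter> {0..<1})"
      using measurable_sets[OF m A] by (intro emeasure_lambda) simp
    also have "to_circle -` (rot \<alpha> -` A) \<inter> {0..<1} = (\<lambda>t. t + \<alpha>) -` (B \<inter> {\<alpha>..<1 + \<alpha>})"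
      by (auto simp: rot_to_circle B_def)
    also have "emeasure lborel \<dots> = emeasure lborel (B \<inter> {\<alpha>..<1 + \<alpha>})"
      by (rule emeasure_lborel_translate) measurable
    also have "B \<inter> {\<alpha>..<1 + \<alpha>} = (B \<inter> {\<alpha>..<1}) \<union> (B \<inter> {1..<1 + \<alpha>})"
      using assms by auto
    also have "emeasure lborel \<dots> =
        emeasure lborel (B \<inter> {\<alpha>..<1}) + emeasure lborel (B \<inter> {1..<1 + \<alpha>})"
      by (rule plus_emeasure[symmetric]) auto
    also have "emeasure lborel (B \<inter> {1..<1 + \<alpha>}) =
        emeasure lborel ((\<lambda>t. t + 1) -` (B \<inter> {1..<1 + \<alpha>}))"
      by (rule emeasure_lborel_translate[symmetric]) measurable
    also have "(\<lambda>t. t + 1) -` (B \<inter> {1..<1 + \<alpha>}) = B \<inter> {0..<\<alpha>}"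
      by (auto simp: per)
    also have "emeasure lborel (B \<inter> {\<alpha>..<1}) + emeasure lborel (B \<inter> {0..<\<alpha>}) =
        emeasure lborel ((B \<inter> {\<alpha>..<1}) \<union> (B \<inter> {0..<\<alpha>}))"
      by (rule plus_emeasure) auto
    also have "(B \<inter> {\<alpha>..<1}) \<union> (B \<inter> {0..<\<alpha>}) = B \<inter> {0..<1}"
      using assms by auto
    also have "emeasure lborel \<dots> = emeasure lambda A"
      using A by (simp add: emeasure_lambda B_def)
    finally show ?thesis .
  qed
  then show ?thesis by (simp add: C_lambda_def continuous_on_rot)
qed

lemma comp_in_C_lambda:
  assumes f: "f \<in> C_lambda" and g: "g \<in> C_lambda"
  shows "f \<circ> g \<in> C_lambda"
proof -
  have cf: "continuous_on UNIV f" and cg: "continuous_on UNIV g"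
    using assms by (auto simp: C_lambda_def)
  have "f -` A \<in> sets borel" if "A \<in> sets borel" for A
    using measurable_sets[OF borel_measurable_continuous_onI[OF cf] that] by simp
  then have "\<forall>A\<in>sets borel. emeasure lambda ((f \<circ> g) -` A) = emeasure lambda A"
    using assms by (simp add: C_lambda_def vimage_comp[symmetric])
  moreover have "continuous_on UNIV (f \<circ> g)"
    using cf cg by (intro continuous_on_compose) (auto intro: continuous_on_subset)
  ultimately show ?thesis by (simp add: C_lambda_def)
qed

lemma T_in_C_lambda:
  assumes "\<alpha> \<in> {0..<1}" "\<beta> \<in> {0..<1}" "f \<in> C_lambda"
  shows "T \<alpha> \<beta> f \<in> C_lambda"
  using assms by (simp add: T_def rot_in_C_lambda comp_in_C_lambda)

end

theory Submission
  imports Defs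
begin

text \<open>
  A measure-preserving map \<open>f\<close> never shrinks an arc \<open>J\<close>, since
  \<open>J \<subseteq> f\<^sup>-\<^sup>1(f(J))\<close>. It lengthens \<open>J\<close> strictly as soon as a point of the
  complement of \<open>J\<close> is mapped into the interior of \<open>f(J)\<close>. Two conditions at a common scale
  \<open>\<eta>\<close>, together called \<open>folding\<close> below, guarantee this for every proper arc: every fibre contains two
  points at distance at least \<open>\<eta>\<close>, and at every point \<open>t\<close> the images of the arcs \<open>[t - \<eta>, t]\<close> and
  \<open>[t, t + \<eta>]\<close> share an arc. By compactness the growth is uniform for arcs of length between any
  \<open>l > 0\<close> and \<open>1 - \<eta>\<close>, and arcs longer than \<open>1 - \<eta>\<close> are mapped onto the circle, because no fibre
  fits into their complement. So a folding measure-preserving map is leo (\<open>folding_imp_leo\<close>).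

  Folding is invariant under rotations in the domain and in the range, which act on the space of
  maps by isometries. The required set is therefore the interior of the set of folding maps, and
  its density is what remains.

  Given \<open>f\<close>, consider \<open>h\<^sub>n \<circ> f \<circ> h\<^sub>m\<close>, where \<open>h\<^sub>n\<close> is a measure-preserving zigzag with \<open>n\<close>
  teeth and slopes \<open>\<plusminus>5\<close>, within \<open>3/n\<close> of the identity. The outer zigzag passes through every
  value transversally at three places, and a map onto the circle has to pass through at least two
  of them, so that each value is taken at two points whose distance is bounded below in terms of \<open>n\<close>
  and \<open>f\<close>. The inner zigzag, much finer than this distance, makes the images of adjacent arcs
  overlap. Both properties persist under perturbation (\<open>zigzag_sandwich_folding\<close>): the first by
  the intermediate value theorem for lifts to the line, the second because the overlaps contain
  images under \<open>h\<^sub>n \<circ> f\<close> of arcs of length \<open>1/m\<close>, which are not shorter. The outer zigzag deals with maps such as the tent map, of degree zero and with a lift whose range has length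
  exactly one: their fibres over values just below the maximum lie in short arcs.
\<close>

section \<open>The circle as a quotient of the line\<close>

lemma to_circle_add_int: "to_circle (t + of_int k) = to_circle t"
  by (simp add: to_circle_eq_iff)

lemma to_circle_add_1: "to_circle (t + 1) = to_circle t"
  using to_circle_add_int[of t 1] by simp

lemma to_circle_eqD:
  assumes "to_circle s = to_circle t"
  obtains k :: int where "s = t + of_int k"
proof -
  have "frac s = frac t" using assms by (simp add: to_circle_eq_iff)
  then have "s = t + of_int (\<lfloor>s\<rfloor> - \<lfloor>t\<rfloor>)" by (simp add: frac_def algebra_simps)
  then show thesis using that by blast
qed

text \<open>The metric is the quotient metric: the distance from \<^term>\<open>to_circle s\<close> to a point is
  realised by the lift of that point nearest to \<open>s\<close>.\<close>

lemma circle_lift_dist: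
  obtains t where "to_circle t = z" "\<bar>s - t\<bar> = dist (to_circle s) z"
proof -
  define r where "r = frac s - Rep_circle z"
  have r: "s - (of_int \<lfloor>s\<rfloor> + Rep_circle z) = r"
    by (simp add: r_def frac_def)
  have b: "-1 < r" "r < 1"
    using Rep_circle[of z] frac_lt_1[of s] frac_ge_0[of s] unfolding r_def atLeastLessThan_iff by linarith+
  have d: "dist (to_circle s) z = min \<bar>r\<bar> (1 - \<bar>r\<bar>)"
    by (simp add: dist_circle_def Rep_to_circle r_def)
  have tc: "to_circle (of_int \<lfloor>s\<rfloor> + Rep_circle z + of_int k) = z" for k
  proof -
    have "of_int \<lfloor>s\<rfloor> + Rep_circle z + of_int k = Rep_circle z + of_int (\<lfloor>s\<rfloor> + k)" by simp
    then show ?thesis using to_circle_add_int to_circle_Rep by metis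
  qed
  define k :: int where "k = (if 2 * \<bar>r\<bar> \<le> 1 then 0 else if r > 0 then 1 else -1)"
  have "\<bar>s - (of_int \<lfloor>s\<rfloor> + Rep_circle z + of_int k)\<bar> = dist (to_circle s) z"
    unfolding d k_def using r b by (auto simp: min_def)
  with tc[of k] show thesis using that by blast
qed

lemma dist_to_circle_ge:
  assumes "e \<le> t - s" "t - s \<le> 1 - e"
  shows "e \<le> dist (to_circle s) (to_circle t)"
proof -
  obtain u where u: "to_circle u = to_circle s" "\<bar>t - u\<bar> = dist (to_circle t) (to_circle s)"
    by (rule circle_lift_dist)
  obtain k where k: "u = s + of_int k" using u(1) by (rule to_circle_eqD)
  consider "k \<le> 0" | "k \<ge> 1" by linarith
  then have "e \<le> \<bar>t - u\<bar>"
  proof cases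
    case 1
    then have "real_of_int k \<le> 0" by simp
    with k assms show ?thesis by linarith
  next
    case 2
    then have "real_of_int k \<ge> 1" by simp
    with k assms show ?thesis by linarith
  qed
  with u show ?thesis by (simp add: dist_commute)
qed

lemma open_to_circle_image:
  assumes "open S"
  shows "open (to_circle ` S)"
  unfolding open_dist
proof (intro ballI)
  fix x assume "x \<in> to_circle ` S"
  then obtain s where s: "s \<in> S" "x = to_circle s" by blast
  then obtain e where e: "e > 0" "\<And>t. dist t s < e \<Longrightarrow> t \<in> S"
    using assms unfolding open_dist by blast
  have "y \<in> to_circle ` S" if "dist y x < e" for y
  proof -
    obtain t where t: "to_circle t = y" "\<bar>s - t\<bar> = dist (to_circle s) y"
      by (rule circle_lift_dist)
    then have "dist t s < e" using that s by (simp add: dist_commute dist_real_def abs_minus_commute)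
    with e t show ?thesis by blast
  qed
  with e show "\<exists>e>0. \<forall>y. dist y x < e \<longrightarrow> y \<in> to_circle ` S" by blast
qed

text \<open>Being continuous, open and onto, \<^term>\<open>to_circle\<close> is a quotient map.\<close>

lemma continuous_on_circleI:
  fixes h :: "circle \<Rightarrow> 'a::topological_space"
  assumes "continuous_on UNIV (\<lambda>t. h (to_circle t))"
  shows "continuous_on UNIV h"
  unfolding continuous_on_open_vimage[OF open_UNIV]
proof (intro allI impI)
  fix B :: "'a set" assume "open B"
  have "h -` B = to_circle ` ((\<lambda>t. h (to_circle t)) -` B)"
  proof (intro set_eqI iffI)
    fix x assume "x \<in> h -` B"
    then show "x \<in> to_circle ` ((\<lambda>t. h (to_circle t)) -` B)"
      by (intro image_eqI[of _ _ "Rep_circle x"]) (simp_all add: to_circle_Rep)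
  qed auto
  moreover have "open ((\<lambda>t. h (to_circle t)) -` B)" using assms \<open>open B\<close> by (intro open_vimage)
  ultimately show "open (h -` B \<inter> UNIV)" using open_to_circle_image by simp
qed

definition circle_arc :: "real \<Rightarrow> real \<Rightarrow> circle set" where
  "circle_arc a b = to_circle ` {a..b}"

lemma compact_arc: "compact (circle_arc a b)"
  unfolding circle_arc_def by (intro compact_continuous_image continuous_on_to_circle) simp

lemma arc_borel [measurable]: "circle_arc a b \<in> sets borel"
  by (intro borel_closed compact_imp_closed compact_arc)

lemma arc_mono: "a' \<le> a \<Longrightarrow> b \<le> b' \<Longrightarrow> circle_arc a b \<subseteq> circle_arc a' b'"
  by (auto simp: circle_arc_def)

lemma arc_shift_int: "circle_arc (a + of_int k) (b + of_int k) = circle_arc a b"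
proof -
  have "{a + of_int k..b + of_int k} = (\<lambda>t. t + of_int k) ` {a..b}" by simp
  then show ?thesis by (simp only: circle_arc_def image_image to_circle_add_int)
qed

lemma rot_image_arc: "rot \<alpha> ` circle_arc a b = circle_arc (a + \<alpha>) (b + \<alpha>)"
proof -
  have "{a + \<alpha>..b + \<alpha>} = (\<lambda>t. t + \<alpha>) ` {a..b}" by simp
  then show ?thesis by (simp only: circle_arc_def image_image rot_to_circle)
qed

lemma rot_rot: "rot \<alpha> (rot \<beta> x) = rot (\<alpha> + \<beta>) x"
  using rot_to_circle[of \<alpha> "Rep_circle x + \<beta>"] by (simp add: rot_def ac_simps)

lemma rot_0: "rot 0 x = x"
  by (simp add: rot_def to_circle_Rep)

lemma rot_vimage: "rot \<alpha> -` S = rot (- \<alpha>) ` S"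
proof -
  have "x = rot (- \<alpha>) (rot \<alpha> x)" "rot \<alpha> (rot (- \<alpha>) x) = x" for x
    by (simp_all add: rot_rot rot_0)
  then show ?thesis by (auto intro: image_eqI)
qed

lemma to_circle_image_period: "to_circle ` {a..<a + 1} = UNIV"
proof -
  have "x \<in> to_circle ` {a..<a + 1}" for x
  proof -
    define t where "t = a + frac (Rep_circle x - a)"
    have "t = Rep_circle x + of_int (- \<lfloor>Rep_circle x - a\<rfloor>)" by (simp add: t_def frac_def)
    then have "to_circle t = x" using to_circle_add_int to_circle_Rep by metis
    moreover have "t \<in> {a..<a + 1}" by (simp add: t_def frac_lt_1)
    ultimately show ?thesis by blast
  qed
  then show ?thesis by blast
qed

lemma arc_eq_UNIV:
  assumes "a + 1 \<le> b"
  shows "circle_arc a b = UNIV"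
proof -
  have "{a..<a + 1} \<subseteq> {a..b}" using assms by auto
  then show ?thesis
    using to_circle_image_period[of a] image_mono[of "{a..<a + 1}" "{a..b}" to_circle]
    by (simp add: circle_arc_def top.extremum_unique)
qed

lemma arc_union: "circle_arc a b \<union> circle_arc b (a + 1) = UNIV" if "a \<le> b" "b \<le> a + 1"
proof -
  have "{a..b} \<union> {b..a + 1} = {a..a + 1}" using that by auto
  then show ?thesis using arc_eq_UNIV[of a "a + 1"] by (simp add: circle_arc_def flip: image_Un)
qed

lemma to_circle_notin_arc:
  assumes "b < s" "s < a + 1"
  shows "to_circle s \<notin> circle_arc a b"
proof
  assume "to_circle s \<in> circle_arc a b"
  then obtain t where t: "a \<le> t" "t \<le> b" "to_circle s = to_circle t" by (auto simp: circle_arc_def)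
  obtain k where k: "s = t + of_int k" using t(3) by (rule to_circle_eqD)
  have "real_of_int k > 0" "real_of_int k < 1" using k assms t by linarith+
  then show False by simp
qed

lemma dist_le_in_arc:
  assumes "x \<in> circle_arc a b" "y \<in> circle_arc a b"
  shows "dist x y \<le> b - a"
proof -
  obtain s t where "s \<in> {a..b}" "t \<in> {a..b}" "x = to_circle s" "y = to_circle t"
    using assms by (auto simp: circle_arc_def)
  then show ?thesis using dist_to_circle_le[of s t] by auto
qed

section \<open>Measure of arcs\<close>

interpretation lambda: finite_measure lambda
  by (rule finite_measureI) (simp add: emeasure_lambda_UNIV)

lemma measure_lambda_UNIV: "measure lambda UNIV = 1"
  by (simp add: measure_def emeasure_lambda_UNIV)

lemma C_lambda_measure:
  assumes "f \<in> C_lambda" "A \<in> sets borel"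
  shows "measure lambda (f -` A) = measure lambda A"
  using assms by (simp add: C_lambda_def measure_def)

lemma C_lambda_cont: "f \<in> C_lambda \<Longrightarrow> continuous_on UNIV f"
  by (simp add: C_lambda_def)

lemma C_lambda_vimage_borel:
  assumes "f \<in> C_lambda" "A \<in> sets borel"
  shows "f -` A \<in> sets borel"
  using measurable_sets[OF borel_measurable_continuous_onI[OF C_lambda_cont[OF assms(1)]] assms(2)]
  by simp

text \<open>A rotation moves the left end of the arc to an integer, so that \<open>[0,1)\<close> cuts the arc at its
  end only.\<close>

lemma measure_arc:
  assumes "a \<le> b"
  shows "measure lambda (circle_arc a b) = min 1 (b - a)"
proof (cases "a + 1 \<le> b")
  case True
  then show ?thesis by (simp add: arc_eq_UNIV measure_lambda_UNIV)
next
  case False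
  define \<alpha> where "\<alpha> = frac a"
  have "rot \<alpha> -` circle_arc a b = circle_arc (a - \<alpha>) (b - \<alpha>)"
    using rot_image_arc[of "-\<alpha>" a b] rot_vimage[of \<alpha> "circle_arc a b"] by simp
  also have "\<dots> = circle_arc 0 (b - a)"
    using arc_shift_int[of 0 "\<lfloor>a\<rfloor>" "b - a"] by (simp add: \<alpha>_def frac_def algebra_simps)
  finally have 1: "measure lambda (circle_arc a b) = measure lambda (circle_arc 0 (b - a))"
    using C_lambda_measure[OF rot_in_C_lambda arc_borel, of \<alpha> a b] by (simp add: \<alpha>_def frac_lt_1)
  have "to_circle t \<in> circle_arc 0 (b - a) \<longleftrightarrow> t \<le> b - a" if "0 \<le> t" "t < 1" for t
  proof
    assume "to_circle t \<in> circle_arc 0 (b - a)"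
    then show "t \<le> b - a" using to_circle_notin_arc[of "b - a" t 0] that by fastforce
  next
    assume "t \<le> b - a"
    then show "to_circle t \<in> circle_arc 0 (b - a)" using that by (simp add: circle_arc_def)
  qed
  then have "to_circle -` circle_arc 0 (b - a) \<inter> {0..<1} = {0..b - a}"
    using False by auto
  then have "emeasure lambda (circle_arc 0 (b - a)) = b - a"
    using assms by (simp add: emeasure_lambda)
  then show ?thesis using 1 False assms by (simp add: measure_def)
qed

lemma measure_open_pos:
  assumes "open V" "V \<noteq> {}"
  shows "measure lambda V > 0"
proof -
  obtain x where x: "x \<in> V" using assms by blast
  have "open (to_circle -` V)"
    using continuous_on_to_circle assms(1) by (simp add: open_vimage)
  moreover have "Rep_circle x \<in> to_circle -` V" using x by (simp add: to_circle_Rep)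
  ultimately obtain e where e: "e > 0" "cball (Rep_circle x) e \<subseteq> to_circle -` V"
    using open_contains_cball by blast
  have "{Rep_circle x..Rep_circle x + e} \<subseteq> cball (Rep_circle x) e"
    by (auto simp: dist_real_def)
  then have "circle_arc (Rep_circle x) (Rep_circle x + e) \<subseteq> V"
    using e(2) unfolding circle_arc_def by blast
  then have "measure lambda (circle_arc (Rep_circle x) (Rep_circle x + e)) \<le> measure lambda V"
    using assms by (intro lambda.finite_measure_mono) auto
  with measure_arc[of "Rep_circle x" "Rep_circle x + e"] e show ?thesis by simp
qed

section \<open>Lifts to the real line\<close>

definition lift_of :: "(real \<Rightarrow> real) \<Rightarrow> (circle \<Rightarrow> circle) \<Rightarrow> bool" where
  "lift_of F f \<longleftrightarrow> continuous_on UNIV F \<and> (\<forall>t. f (to_circle t) = to_circle (F t))"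

text \<open>The circle embeds into the nonzero complex numbers by \<^term>\<open>cis\<close>; a lift is the
  imaginary part of a continuous logarithm along the contractible line, divided by \<open>2\<pi>\<close>.\<close>

lemma lift_exists:
  assumes "continuous_on UNIV f"
  obtains F where "lift_of F f"
proof -
  define e where "e x = cis (2 * pi * Rep_circle x)" for x
  have e: "e (to_circle t) = cis (2 * pi * t)" for t
  proof -
    have "2 * pi * t = 2 * pi * frac t + 2 * pi * of_int \<lfloor>t\<rfloor>" by (simp add: frac_def algebra_simps)
    then have "cis (2 * pi * t) = cis (2 * pi * frac t) * cis (2 * pi * of_int \<lfloor>t\<rfloor>)"
      by (simp only: cis_mult)
    also have "cis (2 * pi * of_int \<lfloor>t\<rfloor>) = 1" by (rule cis_multiple_2pi) simp
    finally show ?thesis by (simp add: e_def Rep_to_circle)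
  qed
  have "continuous_on UNIV (\<lambda>t. e (to_circle t))" unfolding e by (intro continuous_intros)
  then have "continuous_on UNIV e" by (rule continuous_on_circleI)
  then have "continuous_on UNIV (e \<circ> f \<circ> to_circle)"
    using assms by (intro continuous_on_compose continuous_on_to_circle)
      (auto intro: continuous_on_subset)
  then have cont: "continuous_on UNIV (\<lambda>t. e (f (to_circle t)))" by (simp add: comp_def)
  have nz: "e (f (to_circle t)) \<noteq> 0" if "t \<in> UNIV" for t by (simp add: e_def)
  have "contractible (UNIV :: real set)" by (simp add: convex_imp_contractible)
  then obtain g where "continuous_on UNIV g" "\<And>t. t \<in> UNIV \<Longrightarrow> e (f (to_circle t)) = exp (g t)"
    using continuous_logarithm_on_contractible[OF cont _ nz] by metis
  then have g: "continuous_on UNIV g" "\<And>t. e (f (to_circle t)) = exp (g t)" by simp_all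
  define F where "F t = Im (g t) / (2 * pi)" for t
  have "f (to_circle t) = to_circle (F t)" for t
  proof -
    have "Re (g t) = 0"
      using arg_cong[OF g(2)[of t, symmetric], of norm] by (simp add: e_def)
    then have "g t = \<i> * of_real (2 * pi * F t)" by (simp add: complex_eq_iff F_def)
    then have "exp (\<i> * of_real (2 * pi * Rep_circle (f (to_circle t)))) = exp (\<i> * of_real (2 * pi * F t))"
      using g(2)[of t] by (simp add: e_def cis_conv_exp)
    then obtain k where "\<i> * of_real (2 * pi * Rep_circle (f (to_circle t)))
        = \<i> * of_real (2 * pi * F t) + (of_int (2 * k) * pi) * \<i>"
      unfolding exp_eq by blast
    from arg_cong[OF this, of Im]
    have "2 * pi * Rep_circle (f (to_circle t)) = 2 * pi * (F t + of_int k)"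
      by (simp add: algebra_simps)
    then have "Rep_circle (f (to_circle t)) = F t + of_int k"
      by simp
    then show ?thesis using to_circle_add_int to_circle_Rep by metis
  qed
  moreover have "continuous_on UNIV F"
    unfolding F_def using g(1) by (intro continuous_intros) auto
  ultimately have "lift_of F f" by (simp add: lift_of_def)
  then show thesis by (rule that)
qed

lemma lift_of_comp: "lift_of F f \<Longrightarrow> lift_of G g \<Longrightarrow> lift_of (F \<circ> G) (f \<circ> g)"
  unfolding lift_of_def using continuous_on_compose[of UNIV G F] continuous_on_subset by auto

lemma lift_image_arc:
  assumes "lift_of F f" "F ` {a..b} = {c..d}"
  shows "f ` circle_arc a b = circle_arc c d"
proof -
  have "f ` circle_arc a b = to_circle ` F ` {a..b}"
    using assms(1) by (simp add: lift_of_def circle_arc_def image_image)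
  then show ?thesis by (simp add: assms(2) circle_arc_def)
qed

lemma lift_image_interval:
  assumes "lift_of F f" "a \<le> b"
  obtains c d where "F ` {a..b} = {c..d}" "c \<le> d"
proof -
  have "continuous_on {a..b} F" using assms(1) continuous_on_subset by (auto simp: lift_of_def)
  then show thesis using continuous_image_closed_interval[OF assms(2)] that by blast
qed

text \<open>A measure-preserving map does not shrink any set, because
  \<open>J \<subseteq> f\<^sup>-\<^sup>1(f(J))\<close>. For lifts this says that no interval is shortened until
  its image goes once around the circle.\<close>

lemma measure_image_ge:
  assumes "f \<in> C_lambda" "f ` J \<in> sets borel" "J \<in> sets borel"
  shows "measure lambda J \<le> measure lambda (f ` J)"
proof -
  have "measure lambda J \<le> measure lambda (f -` (f ` J))"
    using C_lambda_vimage_borel assms by (intro lambda.finite_measure_mono) auto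
  then show ?thesis using C_lambda_measure assms by simp
qed

lemma lift_spreads:
  assumes "f \<in> C_lambda" "lift_of F f" "a \<le> b" "F ` {a..b} = {c..d}"
  shows "min 1 (b - a) \<le> min 1 (d - c)"
proof -
  have im: "f ` circle_arc a b = circle_arc c d" using assms(2,4) by (rule lift_image_arc)
  have "F a \<in> {c..d}" using assms(3) by (simp flip: assms(4))
  then have "c \<le> d" by simp
  have "measure lambda (circle_arc a b) \<le> measure lambda (circle_arc c d)"
    using measure_image_ge[of f "circle_arc a b"] assms(1) by (simp add: im)
  then show ?thesis
    using measure_arc[OF \<open>a \<le> b\<close>] measure_arc[OF \<open>c \<le> d\<close>] by linarith
qed

text \<open>The difference of two arbitrary lifts stays close to the integers, hence, by continuity, close
  to a single one; subtracting it makes the lifts themselves close.\<close>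

lemma lift_near:
  assumes F: "lift_of F f" and g: "continuous_on UNIV g"
    and d: "\<And>x. dist (g x) (f x) < \<delta>" "\<delta> \<le> 1 / 4"
  obtains G where "lift_of G g" "\<And>t. \<bar>G t - F t\<bar> < \<delta>"
proof -
  obtain G where G: "lift_of G g" using g by (rule lift_exists)
  define D where "D t = G t - F t" for t
  have contD: "continuous_on UNIV D"
    unfolding D_def using F G by (intro continuous_on_diff) (simp_all add: lift_of_def)
  have near: "\<exists>k::int. \<bar>D t - of_int k\<bar> < \<delta>" for t
  proof -
    obtain u where u: "to_circle u = f (to_circle t)" "\<bar>G t - u\<bar> = dist (to_circle (G t)) (f (to_circle t))"
      by (rule circle_lift_dist)
    have "to_circle u = to_circle (F t)" using u(1) F by (simp add: lift_of_def)
    then obtain k where "u = F t + of_int k" by (rule to_circle_eqD)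
    moreover have "\<bar>G t - u\<bar> < \<delta>" using u(2) d(1)[of "to_circle t"] G by (simp add: lift_of_def)
    ultimately have "\<bar>D t - of_int k\<bar> < \<delta>" unfolding D_def by linarith
    then show ?thesis by blast
  qed
  obtain k where k: "\<bar>D 0 - of_int k\<bar> < \<delta>" using near by blast
  have avoid: "D t \<noteq> of_int k + 1/2" "D t \<noteq> of_int k - 1/2" for t
  proof -
    obtain l where l: "\<bar>D t - of_int l\<bar> < \<delta>" using near by blast
    consider "l \<le> k - 1" | "l = k" | "l \<ge> k + 1" by linarith
    then have "real_of_int l \<le> real_of_int k - 1 \<or> real_of_int l = real_of_int k \<or> real_of_int l \<ge> real_of_int k + 1"
      by cases linarith+
    then show "D t \<noteq> of_int k + 1/2" "D t \<noteq> of_int k - 1/2" using l d(2) by linarith+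
  qed
  have ivl: "is_interval (range D)"
    using contD by (simp add: is_interval_connected_1 connected_continuous_image)
  have "\<bar>D t - of_int k\<bar> < 1/2" for t
  proof (rule ccontr)
    assume "\<not> \<bar>D t - of_int k\<bar> < 1/2"
    then have far: "of_int k + 1/2 \<le> D t \<or> D t \<le> of_int k - 1/2" by linarith
    have mid: "x \<in> range D" if "D s \<le> x" "x \<le> D s'" for x s s'
      using ivl that unfolding is_interval_1 by blast
    have "D 0 \<le> of_int k + 1/2" "of_int k - 1/2 \<le> D 0" using k d(2) by linarith+
    then have "of_int k + 1/2 \<in> range D \<or> of_int k - 1/2 \<in> range D"
      using far mid by blast
    then show False using avoid by (metis rangeE)
  qed
  then have "\<bar>D t - of_int k\<bar> < \<delta>" for t
  proof -
    assume *: "\<And>t. \<bar>D t - of_int k\<bar> < 1/2"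
    obtain l where l: "\<bar>D t - of_int l\<bar> < \<delta>" using near by blast
    have "\<bar>real_of_int l - of_int k\<bar> < 1" using l *[of t] d(2) by linarith
    then have "l = k" by linarith
    with l show ?thesis by simp
  qed
  moreover have "lift_of (\<lambda>t. G t - of_int k) g"
    using G to_circle_add_int[of _ "-k"] by (auto simp: lift_of_def intro!: continuous_intros)
  ultimately show thesis using that[of "\<lambda>t. G t - of_int k"] by (simp add: D_def algebra_simps)
qed

section \<open>Folding maps are locally eventually onto\<close>

text \<open>The first clause says that no fibre is contained in a short arc; it governs arcs that are shorter
  than \<open>\<eta>\<close> or whose complement is. The second clause makes the images of the two arcs that
  meet at a point overlap; it governs the arcs in between. One \<open>\<eta>\<close> has to serve both clauses, or
  arcs of intermediate length would escape.\<close>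

definition folding :: "real \<Rightarrow> (circle \<Rightarrow> circle) \<Rightarrow> bool" where
  "folding \<eta> f \<longleftrightarrow>
     (\<forall>y. \<exists>x x'. f x = y \<and> f x' = y \<and> \<eta> \<le> dist x x') \<and>
     (\<forall>t. \<exists>c d. c < d \<and> circle_arc c d \<subseteq> f ` circle_arc (t - \<eta>) t \<inter> f ` circle_arc t (t + \<eta>))"

text \<open>If a point outside \<open>J\<close> is mapped into the interior of \<open>f(J)\<close>, so is a whole neighbourhood,
  and \<open>f\<^sup>-\<^sup>1(f(J))\<close> is larger than \<open>J\<close> by a set of positive measure.\<close>

lemma measure_image_gt:
  assumes f: "f \<in> C_lambda" and "compact J" and U: "open U" "U \<subseteq> f ` J"
    and x: "x \<notin> J" "f x \<in> U"
  shows "measure lambda J < measure lambda (f ` J)"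
proof -
  have "closed J" using \<open>compact J\<close> by (rule compact_imp_closed)
  have "compact (f ` J)"
    using C_lambda_cont[OF f] \<open>compact J\<close> continuous_on_subset by (blast intro: compact_continuous_image)
  then have [measurable]: "f ` J \<in> sets borel" by (intro borel_closed compact_imp_closed)
  define V where "V = f -` U \<inter> - J"
  have "open V"
    unfolding V_def using C_lambda_cont[OF f] U(1) \<open>closed J\<close>
    by (intro open_Int open_vimage) auto
  have "measure lambda J + measure lambda V = measure lambda (J \<union> V)"
    using \<open>closed J\<close> \<open>open V\<close> by (intro lambda.finite_measure_Union[symmetric]) (auto simp: V_def)
  also have "\<dots> \<le> measure lambda (f -` (f ` J))"
    using U(2) C_lambda_vimage_borel[OF f, of "f ` J"]
    by (intro lambda.finite_measure_mono) (auto simp: V_def)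
  also have "\<dots> = measure lambda (f ` J)" using f by (intro C_lambda_measure) auto
  finally have "measure lambda J + measure lambda V \<le> measure lambda (f ` J)" .
  moreover have "V \<noteq> {}" using x by (auto simp: V_def)
  ultimately show ?thesis using measure_open_pos[OF \<open>open V\<close>] by linarith
qed

text \<open>The complement is too short to contain a fibre.\<close>

lemma folding_image_long_arc:
  assumes "folding \<eta> f" "1 - \<eta> < b - a" "a \<le> b"
  shows "f ` circle_arc a b = UNIV"
proof -
  have "y \<in> f ` circle_arc a b" for y
  proof -
    obtain x x' where x: "f x = y" "f x' = y" "\<eta> \<le> dist x x'"
      using assms(1) unfolding folding_def by blast
    have "x \<in> circle_arc a b \<or> x' \<in> circle_arc a b"
    proof (cases "b \<le> a + 1")
      case True
      then have "\<not> (x \<in> circle_arc b (a + 1) \<and> x' \<in> circle_arc b (a + 1))"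
        using dist_le_in_arc[of x b "a + 1" x'] x(3) assms(2) by auto
      then show ?thesis using arc_union[OF assms(3) True] by blast
    qed (simp add: arc_eq_UNIV)
    then show ?thesis using x(1,2) imageI[of x _ f] imageI[of x' _ f] by auto
  qed
  then show ?thesis by auto
qed

text \<open>In each case some point of the complement of the arc leaks into the interior of the image. For a
  short arc the fibre over an interior point of the image is too spread out to lie in the arc. For
  an arc of medium length both the arc and its complement reach \<open>\<eta>\<close> beyond the common end
  point \<open>b\<close>, so their images overlap there.\<close>

lemma folding_expands:
  assumes f: "f \<in> C_lambda" and fold: "folding \<eta> f" and "\<eta> > 0" "a < b" "b < a + 1"
  shows "b - a < measure lambda (f ` circle_arc a b)"
proof -
  let ?J = "circle_arc a b"
  have J: "measure lambda ?J = b - a" using assms by (simp add: measure_arc)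
  have leak: ?thesis if "open U" "U \<subseteq> f ` ?J" "x \<notin> ?J" "f x \<in> U" for U x
    using measure_image_gt[OF f compact_arc that] J by simp
  consider "b - a < \<eta>" | "1 - \<eta> < b - a" | "\<eta> \<le> b - a" "b - a \<le> 1 - \<eta>" by linarith
  then show ?thesis
  proof cases
    case 1
    obtain F where F: "lift_of F f" using C_lambda_cont[OF f] by (rule lift_exists)
    obtain c d where cd: "F ` {a..b} = {c..d}" "c \<le> d"
      by (rule lift_image_interval[OF F, of a b]) (use \<open>a < b\<close> in auto)
    have "c < d" using lift_spreads[OF f F _ cd(1)] \<open>a < b\<close> by (auto simp: min_def split: if_splits)
    have im: "f ` ?J = circle_arc c d" using F cd(1) by (rule lift_image_arc)
    obtain x x' where x: "f x = to_circle ((c + d) / 2)" "f x' = to_circle ((c + d) / 2)" "\<eta> \<le> dist x x'"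
      using fold unfolding folding_def by blast
    then obtain z where "z \<notin> ?J" "f z = to_circle ((c + d) / 2)"
      using dist_le_in_arc[of x a b x'] 1 by fastforce
    moreover have "to_circle ` {c<..<d} \<subseteq> f ` ?J"
      unfolding im unfolding circle_arc_def by (intro image_mono) auto
    ultimately show ?thesis
      using \<open>c < d\<close> by (intro leak[of "to_circle ` {c<..<d}" z] open_to_circle_image) auto
  next
    case 2
    then show ?thesis
      using folding_image_long_arc[OF fold 2] assms by (simp add: measure_lambda_UNIV)
  next
    case 3
    obtain c d where cd: "c < d" "circle_arc c d \<subseteq> f ` circle_arc (b - \<eta>) b \<inter> f ` circle_arc b (b + \<eta>)"
      using fold unfolding folding_def by blast
    have "circle_arc (b - \<eta>) b \<subseteq> ?J" "circle_arc b (b + \<eta>) \<subseteq> circle_arc b (a + 1)"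
      using 3 by (simp_all add: arc_mono)
    then have sub: "circle_arc c d \<subseteq> f ` ?J" "circle_arc c d \<subseteq> f ` circle_arc b (a + 1)"
      using cd(2) by blast+
    define U where "U = to_circle ` {c<..<d}"
    have U: "open U" "U \<subseteq> circle_arc c d" "to_circle ((c + d) / 2) \<in> U"
      using \<open>c < d\<close> by (auto simp: U_def circle_arc_def intro: open_to_circle_image)
    have "to_circle ((c + d) / 2) \<in> f ` to_circle ` {b..a + 1}"
      using sub(2) U(2,3) unfolding circle_arc_def by blast
    then obtain s where "s \<in> {b..a + 1}" "to_circle ((c + d) / 2) = f (to_circle s)" by auto
    then have s: "s \<in> {b..a + 1}" "f (to_circle s) \<in> U" using U(3) by simp_all
    define W where "W = (\<lambda>s. f (to_circle s)) -` U"
    have "continuous_on UNIV (f \<circ> to_circle)"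
      using C_lambda_cont[OF f] by (intro continuous_on_compose continuous_on_to_circle) (auto intro: continuous_on_subset)
    then have "open W" unfolding W_def using U(1) by (intro open_vimage) (auto simp: comp_def)
    moreover have "s \<in> W \<inter> closure {b<..<a + 1}"
      using s \<open>b < a + 1\<close> by (simp add: W_def)
    ultimately obtain s' where "s' \<in> W" "s' \<in> {b<..<a + 1}"
      using open_Int_closure_eq_empty by blast
    then show ?thesis
      using leak[of U "to_circle s'"] U sub(1) to_circle_notin_arc by (auto simp: W_def)
  qed
qed

text \<open>Compactness of the space of arcs of length in \<open>[l, 1 - \<eta>]\<close>. Arcs that hardly grow would
  accumulate at an arc which does not grow: two points where the lift is extremal on the limit arc
  are limits of points of the approximating arcs.\<close>

lemma folding_expands_uniformly:
  assumes f: "f \<in> C_lambda" and fold: "folding \<eta> f" and "\<eta> > 0" "l > 0"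
  obtains \<epsilon> where "\<epsilon> > 0"
    "\<And>a b. l \<le> b - a \<Longrightarrow> b - a \<le> 1 - \<eta> \<Longrightarrow> b - a + \<epsilon> \<le> measure lambda (f ` circle_arc a b)"
proof (rule ccontr)
  note result = that
  assume "\<not> thesis"
  then have no: "\<exists>a b. l \<le> b - a \<and> b - a \<le> 1 - \<eta> \<and> measure lambda (f ` circle_arc a b) < b - a + \<epsilon>"
    if "\<epsilon> > 0" for \<epsilon>
    using that by (metis result not_le)
  \<comment> \<open>arcs are normalised to start in \<open>[0, 1]\<close>, so that their end points range over a compact set\<close>
  define bad where "bad n p \<longleftrightarrow> p \<in> {0..1} \<times> {0..2} \<and> l \<le> snd p - fst p \<and> snd p - fst p \<le> 1 - \<eta> \<and>
      measure lambda (f ` circle_arc (fst p) (snd p)) < snd p - fst p + 1 / real (Suc n)"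
    for n and p :: "real \<times> real"
  have "\<exists>p. bad n p" for n
  proof -
    obtain a b where ab: "l \<le> b - a" "b - a \<le> 1 - \<eta>"
      "measure lambda (f ` circle_arc a b) < b - a + 1 / real (Suc n)"
      using no[of "1 / real (Suc n)"] by auto
    have "b - of_int \<lfloor>a\<rfloor> = frac a + (b - a)" by (simp add: frac_def)
    moreover from this have "0 \<le> b - of_int \<lfloor>a\<rfloor>"
      using ab(1) \<open>l > 0\<close> frac_ge_0[of a] by linarith
    ultimately have "bad n (frac a, b - of_int \<lfloor>a\<rfloor>)"
      using ab arc_shift_int[of "frac a" "\<lfloor>a\<rfloor>" "b - of_int \<lfloor>a\<rfloor>"] frac_lt_1[of a] frac_ge_0[of a]
        \<open>\<eta> > 0\<close> \<open>l > 0\<close>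
      unfolding bad_def by (auto simp: frac_def algebra_simps)
    then show ?thesis by blast
  qed
  then obtain p where p: "bad n (p n)" for n by metis
  have "compact ({0..1} \<times> {0..2} :: (real \<times> real) set)" by (intro compact_Times) auto
  moreover have "\<forall>n. p n \<in> {0..1} \<times> {0..2}" using p by (auto simp: bad_def)
  ultimately obtain q r where q: "strict_mono r" "(p \<circ> r) \<longlonglongrightarrow> q"
    unfolding compact_eq_seq_compact_metric seq_compact_def by blast
  define a b where "a = (\<lambda>n. fst (p (r n)))" and "b = (\<lambda>n. snd (p (r n)))"
  define a0 b0 where "a0 = fst q" and "b0 = snd q"
  have lim: "a \<longlonglongrightarrow> a0" "b \<longlonglongrightarrow> b0"
    using tendsto_fst[OF q(2)] tendsto_snd[OF q(2)] by (simp_all add: a_def b_def a0_def b0_def comp_def)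
  have ab: "l \<le> b n - a n" "b n - a n \<le> 1 - \<eta>"
    "measure lambda (f ` circle_arc (a n) (b n)) < b n - a n + 1 / real (Suc (r n))" for n
    using p[of "r n"] by (simp_all add: bad_def a_def b_def)
  have lim_len: "(\<lambda>n. b n - a n) \<longlonglongrightarrow> b0 - a0" by (intro tendsto_diff lim)
  have len: "l \<le> b0 - a0" "b0 - a0 \<le> 1 - \<eta>"
    using LIMSEQ_le_const[OF lim_len] LIMSEQ_le_const2[OF lim_len] ab(1,2) by blast+
  obtain F where F: "lift_of F f" using C_lambda_cont[OF f] by (rule lift_exists)
  have contF: "isCont F x" for x using F by (simp add: lift_of_def continuous_on_eq_continuous_at)
  obtain c d where cd: "F ` {a0..b0} = {c..d}" "c \<le> d"
    by (rule lift_image_interval[OF F, of a0 b0]) (use len \<open>l > 0\<close> in auto)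
  have "b0 - a0 < min 1 (d - c)"
    using folding_expands[OF f fold \<open>\<eta> > 0\<close>, of a0 b0] len \<open>l > 0\<close> \<open>\<eta> > 0\<close>
      lift_image_arc[OF F cd(1)] measure_arc[OF cd(2)] by simp
  moreover have "min 1 (d - c) \<le> b0 - a0"
  proof -
    obtain s t where st: "s \<in> {a0..b0}" "t \<in> {a0..b0}" "F s = c" "F t = d"
      using cd by (metis atLeastAtMost_iff imageE order_refl)
    \<comment> \<open>transport the extremal points to the approximating arcs, affinely\<close>
    define \<tau> where "\<tau> = (\<lambda>x n. a n + (x - a0) / (b0 - a0) * (b n - a n))"
    have \<tau>_in: "\<tau> x n \<in> {a n..b n}" if "x \<in> {a0..b0}" for x n
    proof -
      have "0 \<le> (x - a0) / (b0 - a0)" "(x - a0) / (b0 - a0) \<le> 1"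
        using that len \<open>l > 0\<close> by (auto simp: divide_simps)
      moreover have "0 \<le> b n - a n" using ab(1)[of n] \<open>l > 0\<close> by simp
      ultimately have "0 \<le> (x - a0) / (b0 - a0) * (b n - a n)"
        "(x - a0) / (b0 - a0) * (b n - a n) \<le> b n - a n"
        using mult_nonneg_nonneg mult_left_le_one_le by blast+
      then show ?thesis by (simp add: \<tau>_def)
    qed
    have "\<tau> x \<longlonglongrightarrow> a0 + (x - a0) / (b0 - a0) * (b0 - a0)" for x
      unfolding \<tau>_def by (intro tendsto_intros lim)
    then have "\<tau> x \<longlonglongrightarrow> x" for x using len \<open>l > 0\<close> by simp
    then have F\<tau>: "(\<lambda>n. F (\<tau> x n)) \<longlonglongrightarrow> F x" for x
      using isCont_tendsto_compose[OF contF] by blast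
    have "min 1 (F (\<tau> t n) - F (\<tau> s n)) \<le> b n - a n + 1 / real (Suc (r n))" for n
    proof -
      have "a n \<le> b n" using ab(1)[of n] \<open>l > 0\<close> by simp
      then obtain c' d' where cd': "F ` {a n..b n} = {c'..d'}" "c' \<le> d'"
        by (rule lift_image_interval[OF F])
      have "F (\<tau> t n) \<in> {c'..d'}" "F (\<tau> s n) \<in> {c'..d'}"
        using \<tau>_in st(1,2) by (auto simp flip: cd'(1))
      then have "F (\<tau> t n) - F (\<tau> s n) \<le> d' - c'" by auto
      moreover have "min 1 (d' - c') < b n - a n + 1 / real (Suc (r n))"
        using ab(3)[of n] lift_image_arc[OF F cd'(1)] measure_arc[OF cd'(2)] by simp
      ultimately show ?thesis by linarith
    qed
    moreover have "(\<lambda>n. min 1 (F (\<tau> t n) - F (\<tau> s n))) \<longlonglongrightarrow> min 1 (d - c)"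
      using F\<tau>[of t] F\<tau>[of s] st by (intro tendsto_intros) auto
    moreover have "(\<lambda>n. b n - a n + 1 / real (Suc (r n))) \<longlonglongrightarrow> b0 - a0 + 0"
      using LIMSEQ_subseq_LIMSEQ[OF LIMSEQ_inverse_real_of_nat q(1)]
      by (intro tendsto_add lim_len) (simp add: comp_def inverse_eq_divide)
    ultimately show ?thesis using LIMSEQ_le by fastforce
  qed
  ultimately show False by linarith
qed

text \<open>Each iterate lengthens an arc by a fixed amount, until its length exceeds \<open>1 - \<eta>\<close> and the next
  image is the circle.\<close>

lemma folding_imp_leo:
  assumes f: "f \<in> C_lambda" and fold: "folding \<eta> f" and "\<eta> > 0"
  shows "leo f"
  unfolding leo_def
proof (intro allI impI, rule ccontr)
  fix U :: "circle set"
  assume U: "open U \<and> U \<noteq> {}" and never: "\<nexists>n. (f ^^ n) ` U = UNIV"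
  obtain x where "x \<in> U" using U by blast
  moreover have "open (to_circle -` U)"
    using U continuous_on_to_circle by (simp add: open_vimage)
  ultimately obtain e where e: "e > 0" "cball (Rep_circle x) e \<subseteq> to_circle -` U"
    using open_contains_cball[of "to_circle -` U"] to_circle_Rep by (metis vimageI)
  define a b where "a = Rep_circle x" and "b = Rep_circle x + e"
  have "{a..b} \<subseteq> cball (Rep_circle x) e" by (auto simp: a_def b_def dist_real_def)
  then have JU: "circle_arc a b \<subseteq> U" using e(2) unfolding circle_arc_def by blast
  obtain F where F: "lift_of F f" using C_lambda_cont[OF f] by (rule lift_exists)
  obtain \<epsilon> where \<epsilon>: "\<epsilon> > 0"
    "\<And>a b. e \<le> b - a \<Longrightarrow> b - a \<le> 1 - \<eta> \<Longrightarrow> b - a + \<epsilon> \<le> measure lambda (f ` circle_arc a b)"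
    using folding_expands_uniformly[OF f fold \<open>\<eta> > 0\<close> e(1)] by blast
  have grow: "\<exists>c d. (f ^^ n) ` circle_arc a b = circle_arc c d \<and> e + real n * \<epsilon> \<le> d - c" for n
  proof (induction n)
    case 0
    show ?case by (intro exI[of _ a] exI[of _ b]) (simp add: a_def b_def)
  next
    case (Suc n)
    then obtain c d where cd: "(f ^^ n) ` circle_arc a b = circle_arc c d" "e + real n * \<epsilon> \<le> d - c"
      by blast
    have "e \<le> d - c" using cd(2) \<epsilon>(1) by (smt (verit) mult_nonneg_nonneg of_nat_0_le_iff)
    then have "c \<le> d" using e(1) by simp
    have im: "(f ^^ Suc n) ` circle_arc a b = f ` circle_arc c d"
      by (simp only: funpow.simps image_comp[symmetric] cd(1))
    have "\<not> 1 - \<eta> < d - c"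
    proof
      assume "1 - \<eta> < d - c"
      then have "(f ^^ Suc n) ` circle_arc a b = UNIV"
        unfolding im using folding_image_long_arc[OF fold _ \<open>c \<le> d\<close>] by simp
      then have "(f ^^ Suc n) ` U = UNIV" using JU by blast
      then show False using never by blast
    qed
    then have *: "d - c + \<epsilon> \<le> measure lambda (f ` circle_arc c d)"
      using \<epsilon>(2)[where a = c and b = d] \<open>e \<le> d - c\<close> by simp
    obtain c' d' where cd': "F ` {c..d} = {c'..d'}" "c' \<le> d'"
      using \<open>c \<le> d\<close> by (rule lift_image_interval[OF F])
    have "f ` circle_arc c d = circle_arc c' d'" using F cd'(1) by (rule lift_image_arc)
    moreover have "d - c + \<epsilon> \<le> d' - c'"
      using * measure_arc[OF cd'(2)] calculation by simp
    then have "e + real (Suc n) * \<epsilon> \<le> d' - c'" using cd(2) by (simp add: algebra_simps)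
    ultimately show ?case using im by auto
  qed
  obtain n where n: "real n * \<epsilon> > 1" using \<epsilon>(1) reals_Archimedean3 by blast
  obtain c d where "(f ^^ n) ` circle_arc a b = circle_arc c d" "e + real n * \<epsilon> \<le> d - c"
    using grow by blast
  then have "(f ^^ n) ` circle_arc a b = UNIV" using n e(1) by (simp add: arc_eq_UNIV)
  then have "(f ^^ n) ` U = UNIV" using JU by blast
  then show False using never by blast
qed

lemma dist_rot: "dist (rot \<alpha> x) (rot \<alpha> y) = dist x y"
  using rot_lipschitz[of \<alpha> x y] rot_lipschitz[of "-\<alpha>" "rot \<alpha> x" "rot \<alpha> y"]
  by (simp add: rot_rot rot_0)

lemma folding_T:
  assumes "folding \<eta> f"
  shows "folding \<eta> (T \<alpha> \<beta> f)"
  unfolding folding_def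
proof (intro conjI allI)
  fix y
  obtain x x' where x: "f x = rot (- \<alpha>) y" "f x' = rot (- \<alpha>) y" "\<eta> \<le> dist x x'"
    using assms unfolding folding_def by blast
  show "\<exists>x x'. T \<alpha> \<beta> f x = y \<and> T \<alpha> \<beta> f x' = y \<and> \<eta> \<le> dist x x'"
    by (intro exI[of _ "rot (- \<beta>) x"] exI[of _ "rot (- \<beta>) x'"]) (simp add: T_def dist_rot rot_rot rot_0 x)
next
  fix t
  have im: "T \<alpha> \<beta> f ` circle_arc a b = rot \<alpha> ` f ` circle_arc (a + \<beta>) (b + \<beta>)" for a b
    by (simp only: T_def image_comp[symmetric] rot_image_arc)
  obtain c d where "c < d" and
    "circle_arc c d \<subseteq> f ` circle_arc (t + \<beta> - \<eta>) (t + \<beta>) \<inter> f ` circle_arc (t + \<beta>) (t + \<beta> + \<eta>)"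
    using assms unfolding folding_def by blast
  then have "rot \<alpha> ` circle_arc c d \<subseteq> rot \<alpha> ` f ` circle_arc (t + \<beta> - \<eta>) (t + \<beta>) \<inter> rot \<alpha> ` f ` circle_arc (t + \<beta>) (t + \<beta> + \<eta>)"
    by (simp add: image_mono)
  moreover have "t + \<beta> - \<eta> = t - \<eta> + \<beta>" "t + \<beta> + \<eta> = t + \<eta> + \<beta>" by simp_all
  ultimately have "circle_arc (c + \<alpha>) (d + \<alpha>) \<subseteq> T \<alpha> \<beta> f ` circle_arc (t - \<eta>) t \<inter> T \<alpha> \<beta> f ` circle_arc t (t + \<eta>)"
    by (simp only: im rot_image_arc)
  with \<open>c < d\<close> show "\<exists>c d. c < d \<and> circle_arc c d
      \<subseteq> T \<alpha> \<beta> f ` circle_arc (t - \<eta>) t \<inter> T \<alpha> \<beta> f ` circle_arc t (t + \<eta>)"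
    by (intro exI[of _ "c + \<alpha>"] exI[of _ "d + \<alpha>"]) simp
qed

section \<open>Measure-preserving zigzags close to the identity\<close>

text \<open>On each \<open>[j, j+1]\<close> the graph rises with slope \<open>5\<close> from \<open>j\<close> to \<open>j + 3\<close> and
  falls with slope \<open>-5\<close> to \<open>j + 1\<close>. Hence almost every value is taken five times, which is what
  preservation of length requires of a function with slopes \<open>\<plusminus>5\<close>. Slope \<open>3\<close> would not do:
  integer values would then be crossed only once, the other preimages being turning points.\<close>

definition saw :: "real \<Rightarrow> real" where
  "saw x = of_int \<lfloor>x\<rfloor> + min (5 * frac x) (6 - 5 * frac x)"

lemma saw_add_int: "saw (x + of_int k) = saw x + of_int k"
  by (simp add: saw_def)

lemma saw_cell:
  assumes "of_int j \<le> x" "x \<le> of_int j + 1"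
  shows "saw x = min (5 * x - 4 * of_int j) (6 + 6 * of_int j - 5 * x)"
proof (cases "x = of_int j + 1")
  case True
  then show ?thesis using saw_add_int[of 0 "j + 1"] by (simp add: saw_def)
next
  case False
  then have "\<lfloor>x\<rfloor> = j" using assms by (intro floor_unique) auto
  then show ?thesis by (simp add: saw_def frac_def min_def)
qed

lemma saw_int: "saw (of_int j) = of_int j"
  by (simp add: saw_cell[of j])

lemma saw_peak: "saw (of_int j + 3/5) = of_int j + 3"
  by (simp add: saw_cell[of j])

lemma saw_near: "\<bar>saw x - x\<bar> \<le> 3"
proof -
  have "saw x = min (5 * x - 4 * of_int \<lfloor>x\<rfloor>) (6 + 6 * of_int \<lfloor>x\<rfloor> - 5 * x)"
    by (rule saw_cell) linarith+
  then show ?thesis unfolding min_def by (cases "5 * x - 4 * of_int \<lfloor>x\<rfloor> \<le> 6 + 6 * of_int \<lfloor>x\<rfloor> - 5 * x") (simp_all, linarith+)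
qed

lemma saw_lipschitz: "\<bar>saw x - saw y\<bar> \<le> 5 * \<bar>x - y\<bar>"
proof (induction x y rule: linorder_wlog)
  case (le x y)
  have cell: "\<bar>saw s - saw t\<bar> \<le> 5 * (t - s)" if "of_int j \<le> s" "s \<le> t" "t \<le> of_int j + 1" for j s t
    using saw_cell[of j s] saw_cell[of j t] that by (simp add: min_def abs_if)
  show ?case
  proof (cases "y \<le> of_int \<lfloor>x\<rfloor> + 1")
    case True
    then show ?thesis using cell[of "\<lfloor>x\<rfloor>" x y] le by simp
  next
    case False
    have i: "\<lfloor>x\<rfloor> + 1 \<le> \<lfloor>y\<rfloor>" using False by (simp add: le_floor_iff)
    then have i': "real_of_int \<lfloor>x\<rfloor> + 1 \<le> of_int \<lfloor>y\<rfloor>" by linarith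
    have "\<bar>saw x - saw (of_int (\<lfloor>x\<rfloor> + 1))\<bar> \<le> 5 * (of_int (\<lfloor>x\<rfloor> + 1) - x)"
      by (rule cell[of "\<lfloor>x\<rfloor>"]) (simp_all, linarith?)
    moreover have "\<bar>saw (of_int \<lfloor>y\<rfloor>) - saw y\<bar> \<le> 5 * (y - of_int \<lfloor>y\<rfloor>)"
      by (rule cell[of "\<lfloor>y\<rfloor>"]) (simp_all, linarith?)
    ultimately show ?thesis using i' le unfolding saw_int by simp
  qed
qed (simp add: abs_minus_commute)

definition zigzag_lift :: "nat \<Rightarrow> real \<Rightarrow> real" where
  "zigzag_lift n t = saw (real n * t) / real n"

definition zigzag :: "nat \<Rightarrow> circle \<Rightarrow> circle" where
  "zigzag n x = to_circle (zigzag_lift n (Rep_circle x))"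

lemma zigzag_lift_near:
  assumes "n > 0"
  shows "\<bar>zigzag_lift n t - t\<bar> \<le> 3 / n"
proof -
  have "zigzag_lift n t - t = (saw (real n * t) - real n * t) / n"
    using assms by (simp add: zigzag_lift_def field_simps)
  then show ?thesis using saw_near[of "real n * t"] assms by (simp add: divide_right_mono)
qed

lemma zigzag_lift_lipschitz:
  assumes "n > 0"
  shows "\<bar>zigzag_lift n s - zigzag_lift n t\<bar> \<le> 5 * \<bar>s - t\<bar>"
proof -
  have "\<bar>zigzag_lift n s - zigzag_lift n t\<bar> = \<bar>saw (real n * s) - saw (real n * t)\<bar> / n"
    by (simp add: zigzag_lift_def diff_divide_distrib[symmetric])
  also have "\<dots> \<le> 5 * \<bar>real n * s - real n * t\<bar> / n"
    by (intro divide_right_mono saw_lipschitz) simp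
  also have "\<dots> = 5 * \<bar>s - t\<bar>"
    using assms by (simp add: abs_mult flip: right_diff_distrib)
  finally show ?thesis .
qed

lemma continuous_zigzag_lift:
  assumes "n > 0"
  shows "continuous_on S (zigzag_lift n)"
proof (rule continuous_on_subset)
  have "5-lipschitz_on UNIV (zigzag_lift n)"
    using zigzag_lift_lipschitz[OF assms] by (intro lipschitz_onI) (auto simp: dist_real_def)
  then show "continuous_on UNIV (zigzag_lift n)" by (rule lipschitz_on_continuous_on)
qed simp

lemma zigzag_lift_add_int:
  assumes "n > 0"
  shows "zigzag_lift n (t + of_int k) = zigzag_lift n t + of_int k"
proof -
  have "real n * (t + of_int k) = real n * t + of_int (int n * k)" by (simp add: algebra_simps)
  then show ?thesis
    using assms by (simp only: zigzag_lift_def saw_add_int) (simp add: field_simps)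
qed

lemma lift_of_zigzag:
  assumes "n > 0"
  shows "lift_of (zigzag_lift n) (zigzag n)"
  unfolding lift_of_def
proof (intro conjI allI continuous_zigzag_lift assms)
  fix t :: real
  have "frac t = t + of_int (- \<lfloor>t\<rfloor>)" by (simp add: frac_def)
  then show "zigzag n (to_circle t) = to_circle (zigzag_lift n t)"
    unfolding zigzag_def Rep_to_circle using zigzag_lift_add_int[OF assms] to_circle_add_int by metis
qed

lemma emeasure_lborel_affine:
  assumes "c \<noteq> 0" "S \<in> sets borel"
  shows "ennreal \<bar>c\<bar> * emeasure lborel ((\<lambda>x. t + c * x) -` S) = emeasure lborel (S :: real set)"
proof -
  have m: "(\<lambda>x. t + c * x) \<in> borel_measurable borel" by measurable
  have "emeasure lborel S = emeasure (density (distr lborel borel (\<lambda>x. t + c * x)) (\<lambda>_. ennreal \<bar>c\<bar>)) S"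
    using lborel_real_affine[OF assms(1)] by metis
  also have "\<dots> = ennreal \<bar>c\<bar> * emeasure (distr lborel borel (\<lambda>x. t + c * x)) S"
    using assms(2) by (simp add: emeasure_density nn_integral_cmult_indicator)
  also have "\<dots> = ennreal \<bar>c\<bar> * emeasure lborel ((\<lambda>x. t + c * x) -` S)"
    using assms(2) by (subst emeasure_distr) auto
  finally show ?thesis by simp
qed

text \<open>The \<open>k\<close>-th cell of length \<open>1/n\<close> is mapped with slope \<open>5\<close> onto the cells \<open>k\<close>, \<open>k + 1\<close>,
  \<open>k + 2\<close> and with slope \<open>-5\<close> onto the cells \<open>k + 2\<close>, \<open>k + 1\<close>. Summed over \<open>k\<close> modulo \<open>n\<close>,
  each of these five contributions is a fifth of the measure of \<open>B\<close>.\<close>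

lemma zigzag_lift_measure:
  assumes n: "n > 0" and B [measurable]: "B \<in> sets borel" and per: "\<And>t. t + 1 \<in> B \<longleftrightarrow> t \<in> B"
  shows "emeasure lborel (zigzag_lift n -` B \<inter> {0..<1}) = emeasure lborel (B \<inter> {0..<1})"
proof -
  define w where "w k = real k / real n" for k
  have w: "w k < w (Suc k)" for k using n by (simp add: w_def divide_strict_right_mono)
  have w_mono: "w k \<le> w l" if "k \<le> l" for k l using that by (simp add: w_def divide_right_mono)
  define \<nu> where "\<nu> S k l = emeasure lborel (S \<inter> {w k..<w l})" for S :: "real set" and k l
  have add: "\<nu> S k l + \<nu> S l m = \<nu> S k m" if "k \<le> l" "l \<le> m" "S \<in> sets borel" for S k l m
  proof -
    have "{w k..<w m} = {w k..<w l} \<union> {w l..<w m}" using w_mono that(1,2) by (intro ivl_disj_un(17)[symmetric])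
    then show ?thesis
      unfolding \<nu>_def using that(3) by (subst plus_emeasure) (auto simp: Int_Un_distrib)
  qed
  have total: "(\<Sum>k<m. \<nu> S k (Suc k)) = \<nu> S 0 m" if "S \<in> sets borel" for S m
  proof (induction m)
    case (Suc m)
    then show ?case using add[of 0 m "Suc m" S] that by simp
  qed (simp add: \<nu>_def)
  have w0n: "w 0 = 0" "w n = 1" using n by (simp_all add: w_def)
  have shift1: "\<nu> B (n + k) (n + l) = \<nu> B k l" for k l
  proof -
    have ws: "w (n + i) = w i + 1" for i using n by (simp add: w_def add_divide_distrib)
    have "(\<lambda>t. t + 1) -` (B \<inter> {w (n + k)..<w (n + l)}) = B \<inter> {w k..<w l}"
      by (auto simp: ws per)
    then show ?thesis
      unfolding \<nu>_def by (metis emeasure_lborel_translate B sets.Int atLeastLessThan_borel)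
  qed
  have rotate: "(\<Sum>k<n. \<nu> B (k + i) (Suc (k + i))) = \<nu> B 0 n" for i
  proof (induction i)
    case 0
    then show ?case by (simp add: total)
  next
    case (Suc i)
    obtain m where m: "n = Suc m" using n by (cases n) auto
    define g where "g k = \<nu> B (k + i) (Suc (k + i))" for k
    have "(\<Sum>k<n. g (Suc k)) = (\<Sum>k<m. g (Suc k)) + g n" by (simp add: m)
    also have "g n = g 0" using shift1[of i "Suc i"] by (simp add: g_def)
    also have "(\<Sum>k<m. g (Suc k)) + g 0 = (\<Sum>k<n. g k)"
      by (simp only: m sum.lessThan_Suc_shift add.commute)
    finally show ?case using Suc by (simp add: g_def)
  qed
  define H where "H = zigzag_lift n"
  have [measurable]: "H \<in> borel_measurable borel"
    unfolding H_def by (intro borel_measurable_continuous_onI continuous_zigzag_lift n)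
  have HB: "H -` B \<in> sets borel"
    using measurable_sets[OF \<open>H \<in> borel_measurable borel\<close> B] by simp
  have cell: "5 * \<nu> (H -` B) k (Suc k) =
      \<nu> B k (k + 1) + \<nu> B (k + 1) (k + 2) + \<nu> B (k + 2) (k + 3) + \<nu> B (k + 1) (k + 2) + \<nu> B (k + 2) (k + 3)" for k
  proof -
    define p where "p = (real k + 3/5) / n"
    have wk: "w (k + 1) = (real k + 1) / n" "w (k + 2) = (real k + 2) / n" "w (k + 3) = (real k + 3) / n" "w k = real k / n"
      by (simp_all add: w_def)
    have p: "w k < p" "p < w (Suc k)" using n by (simp_all add: w_def p_def divide_strict_right_mono)
    have H: "H x = min (5 * x - 4 * real k / n) ((6 + 6 * real k) / n - 5 * x)"
      if "w k \<le> x" "x \<le> w (Suc k)" for x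
    proof -
      have "real_of_int (int k) \<le> real n * x" "real n * x \<le> real_of_int (int k) + 1"
        using that n by (simp_all add: w_def field_simps)
      then have "saw (real n * x) = min (5 * (real n * x) - 4 * real k) (6 + 6 * real k - 5 * (real n * x))"
        using saw_cell by fastforce
      then have "H x = min ((5 * (real n * x) - 4 * real k) / n) ((6 + 6 * real k - 5 * (real n * x)) / n)"
        using n by (simp add: H_def zigzag_lift_def min_def divide_le_cancel)
      then show ?thesis using n by (simp add: field_simps)
    qed
    have sum: "(6 + 10 * real k) / n = (6 + 6 * real k) / n + 4 * real k / n"
      by (simp flip: add_divide_distrib)
    define up down where "up x = - (4 * real k / n) + 5 * x" and "down x = (6 + 6 * real k) / n + (-5) * x" for x
    have U: "H -` B \<inter> {w k..<p} = up -` (B \<inter> {w k..<w (k + 3)})"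
    proof -
      have eq: "H x = up x" if "w k \<le> x" "x < p" for x
      proof -
        have "10 * x \<le> (6 + 10 * real k) / n" using that(2) n by (simp add: p_def field_simps)
        then have "5 * x - 4 * real k / n \<le> (6 + 6 * real k) / n - 5 * x" using sum by linarith
        then show ?thesis using H[of x] that p by (simp add: up_def)
      qed
      have mem: "x \<in> {w k..<p} \<longleftrightarrow> up x \<in> {w k..<w (k + 3)}" for x
      proof -
        have "up x = (5 * (real n * x) - 4 * real k) / n" using n by (simp add: up_def diff_divide_distrib)
        then show ?thesis
          using n by (auto simp: p_def wk pos_divide_le_eq pos_less_divide_eq divide_le_cancel divide_less_cancel mult.commute[of x])
      qed
      show ?thesis
      proof (intro set_eqI)
        fix x
        show "x \<in> H -` B \<inter> {w k..<p} \<longleftrightarrow> x \<in> up -` (B \<inter> {w k..<w (k + 3)})" using eq[of x] mem[of x] by auto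
      qed
    qed
    have D: "H -` B \<inter> {p..<w (Suc k)} = down -` (B \<inter> {w (k + 1)<..w (k + 3)})"
    proof -
      have eq: "H x = down x" if "p \<le> x" "x < w (Suc k)" for x
      proof -
        have "(6 + 10 * real k) / n \<le> 10 * x" using that(1) n by (simp add: p_def field_simps)
        then have "(6 + 6 * real k) / n - 5 * x \<le> 5 * x - 4 * real k / n" using sum by linarith
        then show ?thesis using H[of x] that p by (simp add: down_def)
      qed
      have mem: "x \<in> {p..<w (Suc k)} \<longleftrightarrow> down x \<in> {w (k + 1)<..w (k + 3)}" for x
      proof -
        have "down x = (6 + 6 * real k - 5 * (real n * x)) / n" using n by (simp add: down_def diff_divide_distrib)
        moreover have "w (Suc k) = (real k + 1) / n" using wk(1) by simp
        ultimately show ?thesis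
          using n by (auto simp: p_def wk pos_divide_le_eq pos_less_divide_eq divide_le_cancel divide_less_cancel mult.commute[of x])
      qed
      show ?thesis
      proof (intro set_eqI)
        fix x
        show "x \<in> H -` B \<inter> {p..<w (Suc k)} \<longleftrightarrow> x \<in> down -` (B \<inter> {w (k + 1)<..w (k + 3)})" using eq[of x] mem[of x] by auto
      qed
    qed
    have "{w k..<w (Suc k)} = {w k..<p} \<union> {p..<w (Suc k)}" using p by auto
    then have "\<nu> (H -` B) k (Suc k)
        = emeasure lborel (H -` B \<inter> {w k..<p}) + emeasure lborel (H -` B \<inter> {p..<w (Suc k)})"
      unfolding \<nu>_def using HB by (subst plus_emeasure) (auto simp: Int_Un_distrib)
    also have "5 * \<dots> = 5 * emeasure lborel (up -` (B \<inter> {w k..<w (k + 3)}))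
        + 5 * emeasure lborel (down -` (B \<inter> {w (k + 1)<..w (k + 3)}))"
      by (simp only: U D distrib_left)
    also have "5 * emeasure lborel (up -` (B \<inter> {w k..<w (k + 3)})) = \<nu> B k (k + 3)"
      using emeasure_lborel_affine[of 5 "B \<inter> {w k..<w (k + 3)}" "- (4 * real k / n)"]
      by (simp add: up_def[abs_def] \<nu>_def)
    also have "5 * emeasure lborel (down -` (B \<inter> {w (k + 1)<..w (k + 3)}))
        = emeasure lborel (B \<inter> {w (k + 1)<..w (k + 3)})"
      using emeasure_lborel_affine[of "-5" "B \<inter> {w (k + 1)<..w (k + 3)}" "(6 + 6 * real k) / n"]
      by (simp add: down_def[abs_def])
    \<comment> \<open>the falling branch reverses which end of the interval is included\<close>
    also have "\<dots> = \<nu> B (k + 1) (k + 3)"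
      unfolding \<nu>_def
    proof (rule emeasure_eq_AE)
      show "AE x in lborel. x \<in> B \<inter> {w (k + 1)<..w (k + 3)} \<longleftrightarrow> x \<in> B \<inter> {w (k + 1)..<w (k + 3)}"
        using AE_lborel_singleton[of "w (k + 1)"] AE_lborel_singleton[of "w (k + 3)"]
        by eventually_elim auto
    qed auto
    also have "\<nu> B k (k + 3) = \<nu> B k (k + 1) + \<nu> B (k + 1) (k + 2) + \<nu> B (k + 2) (k + 3)"
      by (simp add: add)
    also have "\<nu> B (k + 1) (k + 3) = \<nu> B (k + 1) (k + 2) + \<nu> B (k + 2) (k + 3)"
      by (simp add: add)
    finally show ?thesis by (simp add: add.assoc)
  qed
  have "5 * \<nu> (H -` B) 0 n = (\<Sum>k<n. 5 * \<nu> (H -` B) k (Suc k))"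
    by (simp only: total[OF HB] flip: sum_distrib_left)
  also have "\<dots> = \<nu> B 0 n + \<nu> B 0 n + \<nu> B 0 n + \<nu> B 0 n + \<nu> B 0 n"
    using rotate[of 0] rotate[of 1] rotate[of 2] by (simp add: cell sum.distrib numeral_3_eq_3)
  also have "\<dots> = 5 * \<nu> B 0 n"
  proof -
    have "(5 :: ennreal) = 1 + 1 + 1 + 1 + 1" by simp
    then show ?thesis by (simp only: distrib_right mult_1)
  qed
  finally have "\<nu> (H -` B) 0 n = \<nu> B 0 n"
    by (simp add: ennreal_mult_cancel_left)
  then show ?thesis by (simp add: \<nu>_def w0n H_def)
qed

lemma zigzag_in_C_lambda:
  assumes "n > 0"
  shows "zigzag n \<in> C_lambda"
proof -
  have lift: "zigzag n (to_circle t) = to_circle (zigzag_lift n t)" for t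
    using lift_of_zigzag[OF assms] by (simp add: lift_of_def)
  have "continuous_on UNIV (to_circle \<circ> zigzag_lift n)"
    by (intro continuous_on_compose continuous_zigzag_lift assms continuous_on_to_circle)
  then have cont: "continuous_on UNIV (zigzag n)"
    by (intro continuous_on_circleI) (simp add: lift comp_def)
  have "emeasure lambda (zigzag n -` A) = emeasure lambda A" if A: "A \<in> sets borel" for A
  proof -
    have B: "to_circle -` A \<in> sets borel"
      using measurable_sets[OF to_circle_borel_measurable A] by simp
    have "zigzag n -` A \<in> sets borel"
      using measurable_sets[OF borel_measurable_continuous_onI[OF cont] A] by simp
    then have "emeasure lambda (zigzag n -` A) = emeasure lborel (to_circle -` (zigzag n -` A) \<inter> {0..<1})"
      by (rule emeasure_lambda)
    also have "to_circle -` (zigzag n -` A) = zigzag_lift n -` (to_circle -` A)"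
      by (auto simp: lift)
    also have "emeasure lborel (\<dots> \<inter> {0..<1}) = emeasure lborel (to_circle -` A \<inter> {0..<1})"
      using assms B by (rule zigzag_lift_measure) (simp add: to_circle_add_1)
    finally show ?thesis using A by (simp add: emeasure_lambda)
  qed
  with cont show ?thesis by (simp add: C_lambda_def)
qed

lemma dist_zigzag:
  assumes "n > 0"
  shows "dist (zigzag n x) x \<le> 3 / n"
  using dist_to_circle_le[of "zigzag_lift n (Rep_circle x)" "Rep_circle x"]
    zigzag_lift_near[OF assms, of "Rep_circle x"]
  by (simp add: zigzag_def to_circle_Rep)

section \<open>Zigzags on both sides force folding robustly\<close>

text \<open>Think of \<open>[c, d]\<close> as the range of a lift of an onto map. Translates of \<open>[z 0, z 3]\<close> need not
  fit into it, but the only gap between consecutive \<open>z i\<close> that can fail to fit is the one that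
  contains \<open>c + 1\<close> modulo \<open>1\<close>.\<close>

lemma two_gaps_fit:
  fixes z :: "nat \<Rightarrow> real"
  assumes "c + 1 \<le> d" "z 0 \<le> z 1" "z 1 \<le> z 2" "z 2 \<le> z 3" "z 3 \<le> z 0 + 1"
  obtains i j :: nat and k l :: int where "i < j" "j < 3"
    "c \<le> z i + of_int k" "z (Suc i) + of_int k \<le> d"
    "c \<le> z j + of_int l" "z (Suc j) + of_int l \<le> d"
proof -
  \<comment> \<open>the translate of \<open>z 0\<close> in \<open>[c, c + 1)\<close>; gaps that overshoot \<open>d\<close> are moved back by one turn\<close>
  define k where "k = \<lceil>c - z 0\<rceil>"
  have k: "c \<le> z 0 + of_int k" "z 0 + of_int k < c + 1" unfolding k_def by linarith+
  have k': "real_of_int (k - 1) = of_int k - 1" by simp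
  consider "z 2 + of_int k \<le> d" | "d < z 2 + of_int k" "z 1 + of_int k \<le> d" | "d < z 1 + of_int k"
    by linarith
  then show thesis
  proof cases
    case 1
    then show thesis using that[of 0 1 k k] k assms by (simp add: numeral_2_eq_2)
  next
    case 2
    then show thesis using that[of 0 2 k "k - 1"] k k' assms by (simp add: numeral_3_eq_3 numeral_2_eq_2)
  next
    case 3
    then show thesis using that[of 1 2 "k - 1" "k - 1"] k k' assms by (simp add: numeral_3_eq_3 numeral_2_eq_2)
  qed
qed

text \<open>The outer map \<open>H\<close> crosses the value \<open>y\<close> with margin \<open>\<gamma>\<close> between \<open>u\<close> and \<open>v\<close>, so a
  perturbation \<open>G\<close> of \<open>H \<circ> \<Phi>\<close> takes the value \<open>y\<close> at some \<open>t\<close>. To find such a \<open>t\<close> with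
  \<open>\<Phi> t\<close> between \<open>u\<close> and \<open>v\<close>, the intermediate value theorem is applied after clamping
  \<open>\<Phi>\<close> to \<open>[u, v]\<close> in the argument of \<open>H\<close>: at a solution the clamp is not active.\<close>

lemma crossing_preimage:
  fixes H \<Phi> G :: "real \<Rightarrow> real"
  assumes cont: "continuous_on UNIV H" "continuous_on UNIV \<Phi>" "continuous_on UNIV G"
    and lip: "\<And>s t. \<bar>H s - H t\<bar> \<le> 5 * \<bar>s - t\<bar>"
    and near: "\<And>t. \<bar>G t - H (\<Phi> t)\<bar> < \<delta>" and "\<delta> \<le> \<gamma> / 2"
    and uv: "u \<le> v" "u \<in> range \<Phi>" "v \<in> range \<Phi>"
    and cross: "H u \<le> y - \<gamma> \<and> y + \<gamma> \<le> H v \<or> H v \<le> y - \<gamma> \<and> y + \<gamma> \<le> H u"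
  obtains t where "G t = y" "u + \<gamma> / 10 \<le> \<Phi> t" "\<Phi> t \<le> v - \<gamma> / 10"
proof -
  define \<kappa> where "\<kappa> t = max u (min v (\<Phi> t))" for t
  define \<Psi> where "\<Psi> t = G t - H (\<Phi> t) + H (\<kappa> t)" for t
  have "0 < \<delta>" using near[of 0] by linarith
  have contH: "continuous_on UNIV (\<lambda>t. H (h t))" if "continuous_on UNIV h" for h :: "real \<Rightarrow> real"
    using continuous_on_compose[OF that continuous_on_subset[OF cont(1)]] by (simp add: comp_def)
  have "continuous_on UNIV \<kappa>"
    unfolding \<kappa>_def using cont(2) by (intro continuous_intros)
  then have "continuous_on UNIV \<Psi>"
    unfolding \<Psi>_def using cont by (intro continuous_on_add continuous_on_diff contH)
  then have ivl: "is_interval (range \<Psi>)"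
    by (simp add: is_interval_connected_1 connected_continuous_image)
  obtain s1 s2 where s: "\<Phi> s1 = u" "\<Phi> s2 = v" using uv by blast
  have \<Psi>s: "\<bar>\<Psi> s1 - H u\<bar> < \<delta>" "\<bar>\<Psi> s2 - H v\<bar> < \<delta>"
    using near[of s1] near[of s2] s \<open>u \<le> v\<close> by (simp_all add: \<Psi>_def \<kappa>_def)
  have mid: "x \<in> range \<Psi>" if "\<Psi> s \<le> x" "x \<le> \<Psi> s'" for x s s'
    using ivl that unfolding is_interval_1 by blast
  have "y \<in> range \<Psi>"
    using cross
  proof
    assume "H u \<le> y - \<gamma> \<and> y + \<gamma> \<le> H v"
    then show ?thesis using \<Psi>s \<open>0 < \<delta>\<close> \<open>\<delta> \<le> \<gamma> / 2\<close> by (intro mid[of s1 _ s2]) linarith+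
  next
    assume "H v \<le> y - \<gamma> \<and> y + \<gamma> \<le> H u"
    then show ?thesis using \<Psi>s \<open>0 < \<delta>\<close> \<open>\<delta> \<le> \<gamma> / 2\<close> by (intro mid[of s2 _ s1]) linarith+
  qed
  then obtain t where t: "\<Psi> t = y" by auto
  then have "\<bar>H (\<kappa> t) - y\<bar> < \<delta>" using near[of t] by (simp add: \<Psi>_def)
  then have "\<gamma> / 2 \<le> \<bar>H (\<kappa> t) - H u\<bar>" "\<gamma> / 2 \<le> \<bar>H (\<kappa> t) - H v\<bar>"
    using cross \<open>\<delta> \<le> \<gamma> / 2\<close> by linarith+
  moreover have "u \<le> \<kappa> t" "\<kappa> t \<le> v" using uv(1) by (simp_all add: \<kappa>_def)
  moreover from this have "\<bar>H (\<kappa> t) - H u\<bar> \<le> 5 * (\<kappa> t - u)" "\<bar>H (\<kappa> t) - H v\<bar> \<le> 5 * (v - \<kappa> t)"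
    using lip[of "\<kappa> t" u] lip[of "\<kappa> t" v] by simp_all
  ultimately have "\<gamma> / 2 \<le> 5 * (\<kappa> t - u)" "\<gamma> / 2 \<le> 5 * (v - \<kappa> t)" by (blast intro: order_trans)+
  then have in_uv: "u + \<gamma> / 10 \<le> \<kappa> t" "\<kappa> t \<le> v - \<gamma> / 10" by simp_all
  then have "\<kappa> t = \<Phi> t"
    using \<open>0 < \<delta>\<close> \<open>\<delta> \<le> \<gamma> / 2\<close> by (auto simp: \<kappa>_def max_def min_def split: if_splits)
  then show thesis using that[of t] t in_uv by (simp add: \<Psi>_def)
qed

lemma zigzag_lift_int: "zigzag_lift n (of_int j / n) = of_int j / n" if "n > 0"
  using that by (simp add: zigzag_lift_def saw_int)

lemma zigzag_lift_peak: "zigzag_lift n ((of_int j + 3/5) / n) = (of_int j + 3) / n" if "n > 0"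
  using that by (simp add: zigzag_lift_def saw_peak)

lemma zigzag_lift_image:
  assumes "n > 0" "p \<le> of_int j / n" "(of_int j + 3/5) / n \<le> q"
  shows "{of_int j / n..(of_int j + 3) / n} \<subseteq> zigzag_lift n ` {p..q}"
proof -
  have "is_interval (zigzag_lift n ` {p..q})"
    using continuous_zigzag_lift[OF assms(1)]
    by (simp add: is_interval_connected_1 connected_continuous_image)
  moreover have "real_of_int j / n \<le> (of_int j + 3/5) / n" by (intro divide_right_mono) auto
  then have "real_of_int j / n \<in> {p..q}" "(of_int j + 3/5) / n \<in> {p..q}" using assms by auto
  then have "of_int j / n \<in> zigzag_lift n ` {p..q}" "(of_int j + 3) / n \<in> zigzag_lift n ` {p..q}"
    using zigzag_lift_int[OF assms(1), of j] zigzag_lift_peak[OF assms(1), of j] by (metis imageI)+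
  ultimately show ?thesis unfolding is_interval_1 by (meson atLeastAtMost_iff subsetI)
qed

text \<open>The outer zigzag gives the first clause of folding. It crosses every value \<open>y\<close> three times with
  margin \<open>1/(2n)\<close>, and the inner onto map passes through at least two of the three crossings. The
  two preimages of \<open>y\<close> are apart after applying \<open>f \<circ> zigzag m\<close>, hence were apart before, by a
  distance that depends on \<open>n\<close> and on the modulus of continuity of \<open>f\<close>, but hardly on \<open>m\<close>.
  This allows \<open>m\<close> to be so large that the scale \<open>2/m\<close>, on which the inner zigzag gives the second
  clause, is below that distance.\<close>

lemma zigzag_sandwich_folding:
  assumes f: "f \<in> C_lambda" and "2 \<le> n" "0 < m" and g: "g \<in> C_lambda"
    and uc: "\<And>x x'. dist x x' < \<eta> \<Longrightarrow> dist (f x) (f x') < 1 / (10 * real n)" and m: "8 / m \<le> \<eta>"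
    and \<delta>: "\<delta> \<le> 1 / (4 * real n)" "\<delta> \<le> 1 / (4 * real m)"
    and near: "\<And>x. dist (g x) (zigzag n (f (zigzag m x))) < \<delta>"
  shows "folding (2 / m) g"
proof -
  have "0 < n" using \<open>2 \<le> n\<close> by simp
  obtain F where F: "lift_of F f" using C_lambda_cont[OF f] by (rule lift_exists)
  define \<Phi> where "\<Phi> = F \<circ> zigzag_lift m"
  have \<Phi>: "lift_of \<Phi> (f \<circ> zigzag m)"
    unfolding \<Phi>_def using F lift_of_zigzag[OF \<open>0 < m\<close>] by (rule lift_of_comp)
  have \<Gamma>: "lift_of (zigzag_lift n \<circ> \<Phi>) (zigzag n \<circ> (f \<circ> zigzag m))"
    using lift_of_zigzag[OF \<open>0 < n\<close>] \<Phi> by (rule lift_of_comp)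
  have "1 / (4 * real n) \<le> 1 / 4" using \<open>2 \<le> n\<close> by (simp add: field_simps)
  then have "\<delta> \<le> 1 / 4" using \<delta>(1) by linarith
  then obtain G where G: "lift_of G g" "\<And>t. \<bar>G t - (zigzag_lift n \<circ> \<Phi>) t\<bar> < \<delta>"
    using lift_near[OF \<Gamma> C_lambda_cont[OF g]] near by (auto simp: comp_def)
  then have Gnear: "\<bar>G t - zigzag_lift n (\<Phi> t)\<bar> < \<delta>" for t by simp
  have contG: "continuous_on S G" for S using G(1) continuous_on_subset by (auto simp: lift_of_def)
  have "\<exists>x x'. g x = y \<and> g x' = y \<and> 2 / m \<le> dist x x'" for y
  proof -
    define y0 where "y0 = Rep_circle y"
    \<comment> \<open>the values \<open>j\<close>, \<open>j + 3\<close>, \<open>j + 1\<close>, \<open>j + 4\<close> of the saw lie alternately below and above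
       \<open>n y0\<close>, at distance at least \<open>1/2\<close>\<close>
    define j where "j = \<lfloor>real n * y0 - 3/2\<rfloor>"
    have j: "real_of_int j + 3/2 \<le> real n * y0" "real n * y0 < real_of_int j + 5/2"
      unfolding j_def by linarith+
    define \<gamma> where "\<gamma> = 1 / (2 * real n)"
    define z :: "nat \<Rightarrow> real" where
      "z i = (if i = 0 then of_int j else if i = 1 then of_int j + 3/5
              else if i = 2 then of_int (j + 1) else of_int (j + 1) + 3/5) / n" for i
    have Hz: "zigzag_lift n (z 0) = of_int j / n" "zigzag_lift n (z 1) = (of_int j + 3) / n"
      "zigzag_lift n (z 2) = of_int (j + 1) / n" "zigzag_lift n (z 3) = (of_int (j + 1) + 3) / n"
      unfolding z_def using zigzag_lift_int[OF \<open>0 < n\<close>, of j] zigzag_lift_peak[OF \<open>0 < n\<close>, of j]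
        zigzag_lift_int[OF \<open>0 < n\<close>, of "j + 1"] zigzag_lift_peak[OF \<open>0 < n\<close>, of "j + 1"] by simp_all
    have low: "zigzag_lift n (z i) \<le> y0 - \<gamma>" if "i \<in> {0, 2}" for i
      using that Hz j \<open>0 < n\<close> by (auto simp: \<gamma>_def field_simps)
    have high: "y0 + \<gamma> \<le> zigzag_lift n (z i)" if "i \<in> {1, 3}" for i
      using that Hz j \<open>0 < n\<close> by (auto simp: \<gamma>_def field_simps)
    have z_le: "z 0 \<le> z 1" "z 1 \<le> z 2" "z 2 \<le> z 3" by (auto simp: z_def intro!: divide_right_mono)
    have "z 3 - z 0 = 8 / 5 / n" by (simp add: z_def flip: diff_divide_distrib)
    moreover have "8 / 5 / real n \<le> 1" using \<open>2 \<le> n\<close> by (simp add: field_simps)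
    ultimately have z_len: "z 3 \<le> z 0 + 1" by linarith
    have "f \<circ> zigzag m \<in> C_lambda" using f zigzag_in_C_lambda[OF \<open>0 < m\<close>] by (rule comp_in_C_lambda)
    moreover obtain c d where cd: "\<Phi> ` {0..1} = {c..d}" "c \<le> d"
      by (rule lift_image_interval[OF \<Phi>, of 0 1]) auto
    ultimately have "c + 1 \<le> d" using lift_spreads[OF _ \<Phi> _ cd(1)] by simp
    then obtain i i' :: nat and k l :: int where ik: "i < i'" "i' < 3"
      "c \<le> z i + of_int k" "z (Suc i) + of_int k \<le> d"
      "c \<le> z i' + of_int l" "z (Suc i') + of_int l \<le> d"
      using two_gaps_fit[OF _ z_le z_len] by blast
    have cross: "\<exists>t. G t = y0 + of_int k \<and> z i + \<gamma> / 10 \<le> \<Phi> t - of_int k \<and> \<Phi> t - of_int k \<le> z (Suc i) - \<gamma> / 10"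
      if "i < 3" "c \<le> z i + of_int k" "z (Suc i) + of_int k \<le> d" for i :: nat and k :: int
    proof -
      have i: "i = 0 \<or> i = 1 \<or> i = 2" using that(1) by auto
      have "z i \<le> z (Suc i)" using i z_le by (auto simp: numeral_2_eq_2 numeral_3_eq_3)
      have alt: "zigzag_lift n (z i) \<le> y0 - \<gamma> \<and> y0 + \<gamma> \<le> zigzag_lift n (z (Suc i)) \<or>
          zigzag_lift n (z (Suc i)) \<le> y0 - \<gamma> \<and> y0 + \<gamma> \<le> zigzag_lift n (z i)"
        using i low[of 0] low[of 2] high[of 1] high[of 3] by (auto simp: numeral_2_eq_2 numeral_3_eq_3)
      have "z i + of_int k \<in> range \<Phi>" "z (Suc i) + of_int k \<in> range \<Phi>"
        using that \<open>z i \<le> z (Suc i)\<close> image_mono[of "{0..1}" UNIV \<Phi>] by (auto simp: cd(1))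
      then obtain t where "G t = y0 + of_int k" "z i + of_int k + \<gamma> / 10 \<le> \<Phi> t" "\<Phi> t \<le> z (Suc i) + of_int k - \<gamma> / 10"
        using crossing_preimage[of "zigzag_lift n" \<Phi> G \<delta> \<gamma> "z i + of_int k" "z (Suc i) + of_int k" "y0 + of_int k"]
          continuous_zigzag_lift[OF \<open>0 < n\<close>] \<Phi> contG zigzag_lift_lipschitz[OF \<open>0 < n\<close>] Gnear \<delta>(1) alt \<open>z i \<le> z (Suc i)\<close>
          zigzag_lift_add_int[OF \<open>0 < n\<close>]
        by (auto simp: lift_of_def \<gamma>_def)
      then show ?thesis by (intro exI[of _ t]) simp
    qed
    obtain t where t: "G t = y0 + of_int k" "z i + \<gamma> / 10 \<le> \<Phi> t - of_int k" "\<Phi> t - of_int k \<le> z (Suc i) - \<gamma> / 10"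
      using cross[of i k] ik by auto
    obtain t' where t': "G t' = y0 + of_int l" "z i' + \<gamma> / 10 \<le> \<Phi> t' - of_int l" "\<Phi> t' - of_int l \<le> z (Suc i') - \<gamma> / 10"
      using cross[of i' l] ik by auto
    have g_eq: "g (to_circle s) = y" if "G s = y0 + of_int k" for s k
      using G(1) that to_circle_add_int by (simp add: lift_of_def y0_def to_circle_Rep)
    have f_eq: "f (zigzag m (to_circle s)) = to_circle (\<Phi> s - of_int k)" for s k
      using \<Phi> to_circle_add_int[of "\<Phi> s" "-k"] by (simp add: lift_of_def)
    have "z (Suc i) \<le> z i'" "z 0 \<le> z i" "z (Suc i') \<le> z 3"
    proof -
      have "i = 0 \<and> i' = 1 \<or> i = 0 \<and> i' = 2 \<or> i = 1 \<and> i' = 2" using ik by auto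
      then show "z (Suc i) \<le> z i'" "z 0 \<le> z i" "z (Suc i') \<le> z 3"
        using z_le by (auto simp: numeral_2_eq_2 numeral_3_eq_3)
    qed
    then have "1 / (10 * real n) \<le> dist (to_circle (\<Phi> t - of_int k)) (to_circle (\<Phi> t' - of_int l))"
      using t t' z_len by (intro dist_to_circle_ge) (auto simp: \<gamma>_def)
    then have "\<not> dist (f (zigzag m (to_circle t))) (f (zigzag m (to_circle t'))) < 1 / (10 * real n)"
      unfolding f_eq[of t k] f_eq[of t' l] by simp
    then have "\<eta> \<le> dist (zigzag m (to_circle t)) (zigzag m (to_circle t'))"
      by (intro leI) (use uc in blast)
    also have "\<dots> \<le> dist (zigzag m (to_circle t)) (to_circle t) + dist (to_circle t) (to_circle t')
        + dist (to_circle t') (zigzag m (to_circle t'))"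
      using dist_triangle[of "zigzag m (to_circle t)" "zigzag m (to_circle t')" "to_circle t"]
        dist_triangle[of "to_circle t" "zigzag m (to_circle t')" "to_circle t'"] by linarith
    also have "\<dots> \<le> 6 / m + dist (to_circle t) (to_circle t')"
      using dist_zigzag[OF \<open>0 < m\<close>, of "to_circle t"] dist_zigzag[OF \<open>0 < m\<close>, of "to_circle t'"]
      by (simp add: dist_commute)
    finally have "2 / m \<le> dist (to_circle t) (to_circle t')" using m by simp
    then show ?thesis using g_eq t(1) t'(1) by blast
  qed
  moreover have "\<exists>c d. c < d \<and> circle_arc c d \<subseteq> g ` circle_arc (t - 2 / m) t \<inter> g ` circle_arc t (t + 2 / m)" for t
  proof -
    define j where "j = \<lceil>real m * t\<rceil>"
    have j: "real m * t \<le> j" "j < real m * t + 1" unfolding j_def by linarith+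
    have ts: "t - 2 / m = (real m * t - 2) / m" "t + 2 / m = (real m * t + 2) / m"
      using \<open>0 < m\<close> by (simp_all add: diff_divide_distrib add_divide_distrib)
    \<comment> \<open>a cell that the inner zigzag covers from either side of \<open>t\<close>\<close>
    define I where "I = {of_int j / real m..(of_int j + 1) / real m}"
    have IL: "I \<subseteq> zigzag_lift m ` {t - 2 / m..t}"
    proof -
      have "{of_int (j - 2) / real m..(of_int (j - 2) + 3) / real m} \<subseteq> zigzag_lift m ` {t - 2 / m..t}"
        using j \<open>0 < m\<close> unfolding ts(1)
        by (intro zigzag_lift_image) (auto simp: divide_le_cancel pos_divide_le_eq mult.commute)
      moreover have "I \<subseteq> {of_int (j - 2) / real m..(of_int (j - 2) + 3) / real m}"
        unfolding I_def using \<open>0 < m\<close> by (simp add: divide_right_mono)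
      ultimately show ?thesis by blast
    qed
    have IR: "I \<subseteq> zigzag_lift m ` {t..t + 2 / m}"
    proof -
      have "{of_int j / real m..(of_int j + 3) / real m} \<subseteq> zigzag_lift m ` {t..t + 2 / m}"
        using j \<open>0 < m\<close> unfolding ts(2)
        by (intro zigzag_lift_image) (auto simp: divide_le_cancel pos_le_divide_eq mult.commute)
      moreover have "I \<subseteq> {of_int j / real m..(of_int j + 3) / real m}"
        unfolding I_def using \<open>0 < m\<close> by (simp add: divide_right_mono)
      ultimately show ?thesis by blast
    qed
    have \<Psi>: "lift_of (zigzag_lift n \<circ> F) (zigzag n \<circ> f)"
      using lift_of_zigzag[OF \<open>0 < n\<close>] F by (rule lift_of_comp)
    have "real_of_int j / m \<le> (of_int j + 1) / m" by (simp add: divide_right_mono)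
    then obtain c d where cd: "(zigzag_lift n \<circ> F) ` I = {c..d}" "c \<le> d"
      unfolding I_def by (rule lift_image_interval[OF \<Psi>])
    have "1 / real m \<le> d - c"
    proof -
      have "min 1 ((of_int j + 1) / real m - of_int j / real m) \<le> min 1 (d - c)"
        using comp_in_C_lambda[OF zigzag_in_C_lambda[OF \<open>0 < n\<close>] f] \<Psi> \<open>real_of_int j / m \<le> _\<close> cd(1)[unfolded I_def]
        by (rule lift_spreads)
      moreover have "(of_int j + 1) / real m - of_int j / real m = 1 / real m"
        by (simp flip: diff_divide_distrib)
      moreover have "1 / real m \<le> 1" using \<open>0 < m\<close> by simp
      ultimately show ?thesis by linarith
    qed
    moreover have "1 / (4 * real m) = (1 / real m) / 4" "0 < 1 / real m" using \<open>0 < m\<close> by simp_all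
    ultimately have "c + \<delta> < d - \<delta>" using \<delta>(2) by linarith
    have cover: "circle_arc (c + \<delta>) (d - \<delta>) \<subseteq> g ` circle_arc p q" if I: "I \<subseteq> zigzag_lift m ` {p..q}" for p q
    proof -
      have hit: "\<exists>s\<in>{p..q}. \<bar>G s - v\<bar> < \<delta>" if "v \<in> {c..d}" for v
      proof -
        have "v \<in> (zigzag_lift n \<circ> F) ` I" using that by (simp only: cd(1))
        then obtain x where "x \<in> I" "v = zigzag_lift n (F x)" by auto
        then obtain s where "s \<in> {p..q}" "v = zigzag_lift n (\<Phi> s)" using I by (auto simp: \<Phi>_def)
        then show ?thesis using Gnear[of s] by blast
      qed
      obtain s s' where s: "s \<in> {p..q}" "\<bar>G s - c\<bar> < \<delta>" "s' \<in> {p..q}" "\<bar>G s' - d\<bar> < \<delta>"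
        using hit[of c] hit[of d] cd(2) by auto
      have "is_interval (G ` {p..q})"
        using contG by (simp add: is_interval_connected_1 connected_continuous_image)
      moreover have "G s \<in> G ` {p..q}" "G s' \<in> G ` {p..q}" using s by auto
      moreover have "G s \<le> c + \<delta>" "d - \<delta> \<le> G s'" using s by linarith+
      ultimately have "{c + \<delta>..d - \<delta>} \<subseteq> G ` {p..q}"
        unfolding is_interval_1 by (smt (verit) atLeastAtMost_iff subsetI)
      then have "to_circle ` {c + \<delta>..d - \<delta>} \<subseteq> to_circle ` G ` {p..q}" by (rule image_mono)
      also have "\<dots> = g ` circle_arc p q" using G(1) by (simp add: lift_of_def circle_arc_def image_image)
      finally show ?thesis by (simp add: circle_arc_def)
    qed
    show ?thesis
      using \<open>c + \<delta> < d - \<delta>\<close> cover[OF IL] cover[OF IR] by (intro exI[of _ "c + \<delta>"] exI[of _ "d - \<delta>"]) simp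
  qed
  ultimately show ?thesis unfolding folding_def by blast
qed

section \<open>The open dense set\<close>

lemma rho_upper: "dist (f x) (g x) \<le> rho f g"
  unfolding rho_def by (intro cSUP_upper bdd_aboveI2[where M = "1 / 2"] dist_circle_le) simp

lemma rho_least: "(\<And>x. dist (f x) (g x) \<le> e) \<Longrightarrow> rho f g \<le> e"
  unfolding rho_def by (intro cSUP_least) auto

interpretation C_lambda: Metric_space C_lambda rho
  by (rule Metric_space_C_lambda)

lemma C_lambda_uniformly_continuous:
  assumes "f \<in> C_lambda" "e > 0"
  obtains d where "d > 0" "\<And>x y. dist x y < d \<Longrightarrow> dist (f x) (f y) < e"
proof -
  have "compact (UNIV :: circle set)" using compact_arc[of 0 1] by (simp add: arc_eq_UNIV)
  then have "uniformly_continuous_on UNIV f"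
    using C_lambda_cont[OF assms(1)] compact_uniformly_continuous by blast
  then show thesis using assms(2) that unfolding uniformly_continuous_on_def by (metis UNIV_I dist_commute)
qed

text \<open>The interior of the set of maps that are folding at some scale.\<close>

definition robustly_folding :: "(circle \<Rightarrow> circle) set" where
  "robustly_folding = {f \<in> C_lambda. \<exists>\<delta>>0. \<forall>g\<in>C_lambda. rho f g < \<delta> \<longrightarrow> (\<exists>\<eta>>0. folding \<eta> g)}"

text \<open>Composing \<open>f\<close> with zigzags of small amplitude on both sides changes it by little. The outer
  frequency \<open>n\<close> is fixed by \<open>\<epsilon>\<close>, the inner one \<open>m\<close> by \<open>\<epsilon>\<close>, \<open>n\<close> and \<open>f\<close>.\<close>

lemma robustly_folding_dense:
  assumes f: "f \<in> C_lambda" and "\<epsilon> > 0"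
  obtains g where "g \<in> robustly_folding" "rho f g < \<epsilon>"
proof -
  obtain n :: nat where n: "max 2 (6 / \<epsilon>) < n" using reals_Archimedean2 by blast
  have "2 \<le> n" "0 < n" using n by auto
  have n_close: "3 / n < \<epsilon> / 2" using n \<open>\<epsilon> > 0\<close> \<open>0 < n\<close> by (simp add: field_simps)
  obtain \<eta> where \<eta>: "\<eta> > 0" "\<And>x y. dist x y < \<eta> \<Longrightarrow> dist (f x) (f y) < 1 / (10 * real n)"
    using C_lambda_uniformly_continuous[OF f, of "1 / (10 * real n)"] \<open>0 < n\<close> by auto
  obtain \<eta>' where \<eta>': "\<eta>' > 0" "\<And>x y. dist x y < \<eta>' \<Longrightarrow> dist (f x) (f y) < \<epsilon> / 4"
    using C_lambda_uniformly_continuous[OF f, of "\<epsilon> / 4"] \<open>\<epsilon> > 0\<close> by auto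
  obtain m :: nat where m: "max (8 / \<eta>) (3 / \<eta>') < m" using reals_Archimedean2 by blast
  have "0 < 8 / \<eta>" using \<eta>(1) by simp
  then have "0 < real m" using m by linarith
  then have "0 < m" by simp
  have m_close: "8 / m \<le> \<eta>" "3 / m < \<eta>'" using m \<eta>(1) \<eta>'(1) \<open>0 < m\<close> by (simp_all add: field_simps)
  define g where "g = zigzag n \<circ> (f \<circ> zigzag m)"
  have g: "g \<in> C_lambda"
    unfolding g_def using f zigzag_in_C_lambda[OF \<open>0 < n\<close>] zigzag_in_C_lambda[OF \<open>0 < m\<close>]
    by (intro comp_in_C_lambda)
  have "dist (f x) (g x) \<le> 3 / n + \<epsilon> / 4" for x
  proof -
    have "dist x (zigzag m x) < \<eta>'"
      using dist_zigzag[OF \<open>0 < m\<close>, of x] m_close(2) by (simp add: dist_commute)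
    then have "dist (f x) (f (zigzag m x)) < \<epsilon> / 4" by (rule \<eta>'(2))
    moreover have "dist (f (zigzag m x)) (g x) \<le> 3 / n"
      using dist_zigzag[OF \<open>0 < n\<close>, of "f (zigzag m x)"] by (simp add: g_def dist_commute)
    ultimately show ?thesis using dist_triangle[of "f x" "g x" "f (zigzag m x)"] by linarith
  qed
  then have "rho f g \<le> 3 / n + \<epsilon> / 4" by (rule rho_least)
  then have "rho f g < \<epsilon>" using n_close \<open>\<epsilon> > 0\<close> by linarith
  moreover have "g \<in> robustly_folding"
  proof -
    define \<delta> where "\<delta> = min (1 / (4 * real n)) (1 / (4 * real m))"
    have "\<exists>\<eta>>0. folding \<eta> g'" if "g' \<in> C_lambda" "rho g g' < \<delta>" for g'
    proof -
      have "dist (g' x) (zigzag n (f (zigzag m x))) < \<delta>" for x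
        using rho_upper[of g x g'] that(2) by (simp add: g_def dist_commute)
      then have "folding (2 / m) g'"
        using f \<open>2 \<le> n\<close> \<open>0 < m\<close> that(1) \<eta>(2) m_close(1)
        by (intro zigzag_sandwich_folding[of f n m g' \<eta> \<delta>]) (simp_all add: \<delta>_def)
      then show ?thesis using \<open>0 < m\<close> by (intro exI[of _ "2 / real m"]) simp
    qed
    moreover have "\<delta> > 0" using \<open>0 < n\<close> \<open>0 < m\<close> by (simp add: \<delta>_def)
    ultimately show ?thesis using g unfolding robustly_folding_def by blast
  qed
  ultimately show thesis using that by blast
qed

lemma robustly_folding_open: "openin C_lambda_topology robustly_folding"
  unfolding C_lambda.openin_mtopology
proof (intro conjI allI impI)
  show "robustly_folding \<subseteq> C_lambda" by (auto simp: robustly_folding_def)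
next
  fix f assume "f \<in> robustly_folding"
  then obtain \<delta> where \<delta>: "\<delta> > 0" "f \<in> C_lambda"
    "\<And>g. g \<in> C_lambda \<Longrightarrow> rho f g < \<delta> \<Longrightarrow> \<exists>\<eta>>0. folding \<eta> g"
    unfolding robustly_folding_def by blast
  have "g \<in> robustly_folding" if g: "g \<in> C_lambda.mball f (\<delta> / 2)" for g
  proof -
    have g': "g \<in> C_lambda" "rho f g < \<delta> / 2" using g by auto
    have "\<exists>\<eta>>0. folding \<eta> h" if "h \<in> C_lambda" "rho g h < \<delta> / 2" for h
      using \<delta>(3)[OF that(1)] C_lambda.triangle[OF \<delta>(2) g'(1) that(1)] g'(2) that(2) by simp
    then show ?thesis
      using g'(1) \<delta>(1) unfolding robustly_folding_def by (intro CollectI conjI exI[of _ "\<delta> / 2"]) auto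
  qed
  then show "\<exists>r>0. C_lambda.mball f r \<subseteq> robustly_folding"
    using \<delta>(1) by (intro exI[of _ "\<delta> / 2"]) auto
qed

lemma rho_T: "rho (T \<alpha> \<beta> f) (T \<alpha> \<beta> g) = rho f g"
proof -
  have "range (\<lambda>x. dist (f (rot \<beta> x)) (g (rot \<beta> x))) = (\<lambda>x. dist (f x) (g x)) ` range (rot \<beta>)"
    by (simp add: image_image)
  moreover have "range (rot \<beta>) = UNIV"
    by (intro surjI[of _ "rot (- \<beta>)"]) (simp add: rot_rot rot_0)
  ultimately show ?thesis by (simp add: rho_def T_def dist_rot)
qed

lemma rot_frac: "rot (frac \<alpha>) = rot \<alpha>"
proof
  fix x
  have "rot (frac \<alpha>) x = to_circle (Rep_circle x + \<alpha> + of_int (- \<lfloor>\<alpha>\<rfloor>))"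
    by (simp add: rot_def frac_def algebra_simps)
  then show "rot (frac \<alpha>) x = rot \<alpha> x" by (simp only: to_circle_add_int rot_def)
qed

text \<open>\<open>T\<close> is an isometric bijection that preserves folding.\<close>

lemma T_robustly_folding:
  assumes f: "f \<in> robustly_folding"
  shows "T \<alpha> \<beta> f \<in> robustly_folding"
proof -
  have inC: "T \<alpha> \<beta> g \<in> C_lambda" if "g \<in> C_lambda" for \<alpha> \<beta> g
    using T_in_C_lambda[of "frac \<alpha>" "frac \<beta>" g] that by (simp add: frac_lt_1 T_def rot_frac)
  have inv: "T \<alpha> \<beta> (T (- \<alpha>) (- \<beta>) g) = g" for g
    by (simp add: T_def fun_eq_iff rot_rot rot_0)
  obtain \<delta> where \<delta>: "\<delta> > 0" "f \<in> C_lambda"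
    "\<And>g. g \<in> C_lambda \<Longrightarrow> rho f g < \<delta> \<Longrightarrow> \<exists>\<eta>>0. folding \<eta> g"
    using f unfolding robustly_folding_def by blast
  have "\<exists>\<eta>>0. folding \<eta> g" if "g \<in> C_lambda" "rho (T \<alpha> \<beta> f) g < \<delta>" for g
  proof -
    let ?g = "T (- \<alpha>) (- \<beta>) g"
    have "?g \<in> C_lambda" using that(1) by (rule inC)
    moreover have "rho f ?g < \<delta>" using that(2) rho_T[of \<alpha> \<beta> f ?g] by (simp add: inv)
    ultimately obtain \<eta> where "\<eta> > 0" "folding \<eta> ?g" using \<delta>(3) by blast
    then show ?thesis using folding_T[of \<eta> ?g \<alpha> \<beta>] by (auto simp: inv)
  qed
  then show ?thesis using \<delta>(1) inC[OF \<delta>(2)] unfolding robustly_folding_def by blast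
qed

theorem theorem1:
  shows "\<exists>\<O>. \<O> \<subseteq> C_lambda
     \<and> openin C_lambda_topology \<O>
     \<and> C_lambda_topology closure_of \<O> = C_lambda
     \<and> (\<forall>f\<in>\<O>. leo f)
     \<and> (\<forall>\<alpha>\<in>{0..<1}. \<forall>\<beta>\<in>{0..<1}. \<forall>f\<in>\<O>. T \<alpha> \<beta> f \<in> \<O>)"
proof (intro exI[of _ robustly_folding] conjI ballI)
  show sub: "robustly_folding \<subseteq> C_lambda" by (auto simp: robustly_folding_def)
  show "openin C_lambda_topology robustly_folding" by (rule robustly_folding_open)
  show "C_lambda_topology closure_of robustly_folding = C_lambda"
  proof -
    have "\<exists>g\<in>robustly_folding. g \<in> C_lambda.mball f r" if "f \<in> C_lambda" "r > 0" for f r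
      using robustly_folding_dense[OF that] sub that(1) by (metis C_lambda.in_mball subsetD)
    then show ?thesis unfolding C_lambda.metric_closure_of by blast
  qed
next
  fix f assume f: "f \<in> robustly_folding"
  then have "f \<in> C_lambda" "rho f f = 0" by (auto simp: robustly_folding_def)
  with f obtain \<eta> where "\<eta> > 0" "folding \<eta> f" unfolding robustly_folding_def by fastforce
  with \<open>f \<in> C_lambda\<close> show "leo f" by (intro folding_imp_leo)
next
  fix \<alpha> \<beta> f assume "f \<in> robustly_folding"
  then show "T \<alpha> \<beta> f \<in> robustly_folding" by (rule T_robustly_folding)
qed

end
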